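(* Let $K$ be a $d$-dimensional simplicial complex which is a triangulation of an orientable $d$-manifold, and let $m=|K_d|$, $n=|K_{d-1}|$. Then $$\det(\Delta_d+\lambda I)=\sum_{i=0}^{n}|\mathcal{M}_{m-i}(K)|\,\lambda^{n-i},$$ where $\mathcal{M}_k(K)=\emptyset$ for $k<0$.
   Context: A simplicial complex $K$ is a finite family of finite sets closed under subsets; $K_p$ is the set of $p$-cells (elements of size $p+1$). The incidence matrix $\partial_d$ has rows indexed by $K_{d-1}$, columns by $K_d$, entry $(-1)^j$ at $(r,f)$ if $f=\{v_0<\dots<v_d\}$, $r=f\setminus\{v_j\}$, and $0$ otherwise. The $d$-th Laplacian is the $|K_{d-1}|\times|K_{d-1}|$ matrix $\Delta_d=\partial_d\partial_d^T$, and $I$ is the identity of that size. A discrete Morse function is $f:K\to\mathbb{R}$ such that each $p$-cell $\sigma$ has at most one $(p-1)$-face $\tau$ with $f(\tau)\ge f(\sigma)$ and at most one $(p+1)$-coface $\tau$ with $f(\tau)\le f(\sigma)$; $\sigma$ is critical if there are none; $c_p(f)$ counts critical $p$-cells. The gradient is $V_f=\{(\sigma,\tau):\sigma\text{ a codimension-one face of }\tau,\ f(\tau)\le f(\sigma)\}$; $\mathcal{M}(K)$ is the set of discrete Morse functions modulo $f\sim g$ iff $V_f=V_g$; $\mathcal{M}_\ell(K)=\{f\in\mathcal{M}(K): c_d(f)=\ell,\ c_p(f)=|K_p|\ \forall p<d-1\}$. A triangulation of an orientable $d$-manifold is a simplicial complex whose geometric realization is homeomorphic to an orientable $d$-manifold.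 *)

theory Defs
  imports
    "HOL-Analysis.Analysis"
    "HOL-Homology.Homology"
    "Jordan_Normal_Form.Determinant"
begin

section \<open>Simplicial complexes\<close>

text \<open>Closure under subsets makes the empty set a cell, of dimension $-1$, of every nonempty
  complex. Dimensions are integers so that it is treated like any other cell.\<close>

definition abstract_simplicial_complex :: "'a set set \<Rightarrow> bool" where
  "abstract_simplicial_complex K \<longleftrightarrow>
     finite K \<and> (\<forall>\<sigma>\<in>K. finite \<sigma> \<and> (\<forall>\<tau>. \<tau> \<subseteq> \<sigma> \<longrightarrow> \<tau> \<in> K))"

definition cells :: "'a set set \<Rightarrow> int \<Rightarrow> 'a set set" where
  "cells K p = {\<sigma> \<in> K. int (card \<sigma>) = p + 1}"

definition has_dimension :: "'a set set \<Rightarrow> int \<Rightarrow> bool" where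
  "has_dimension K d \<longleftrightarrow> cells K d \<noteq> {} \<and> (\<forall>\<sigma>\<in>K. int (card \<sigma>) \<le> d + 1)"

definition codim1_face :: "'a set \<Rightarrow> 'a set \<Rightarrow> bool" where
  "codim1_face \<sigma> \<tau> \<longleftrightarrow> \<sigma> \<subseteq> \<tau> \<and> card \<tau> = card \<sigma> + 1"

text \<open>Points of the realization are given by their barycentric coordinates. As only the finitely
  many vertices of the complex can have nonzero coordinates, the product topology induces
  the Euclidean one.\<close>

definition geometric_realization :: "'a set set \<Rightarrow> ('a \<Rightarrow> real) topology" where
  "geometric_realization K =
     subtopology (powertop_real UNIV)
       {x. (\<forall>v. 0 \<le> x v) \<and> {v. x v \<noteq> 0} \<in> K \<and> (\<Sum>v\<in>{v. x v \<noteq> 0}. x v) = 1}"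


section \<open>Incidence matrix and Laplacian\<close>

text \<open>At most one summand is nonzero: the one for the position \<open>j\<close> of the vertex of \<open>f\<close> that
  is missing in \<open>r\<close>.\<close>

definition incidence :: "'a::linorder set \<Rightarrow> 'a set \<Rightarrow> real" where
  "incidence r f =
     (\<Sum>j<card f. if r = f - {sorted_list_of_set f ! j} then (-1) ^ j else 0)"

text \<open>Matrices are indexed by natural numbers, so rows and columns are numbered by some fixed
  enumeration of the cells. The choice conjugates the Laplacian by a permutation matrix and
  does not affect determinants.\<close>

definition cell_list :: "'a set set \<Rightarrow> int \<Rightarrow> 'a set list" where
  "cell_list K p = (SOME xs. distinct xs \<and> set xs = cells K p)"

definition incidence_matrix :: "'a::linorder set set \<Rightarrow> int \<Rightarrow> real mat" where
  "incidence_matrix K d =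
     mat (card (cells K (d - 1))) (card (cells K d))
       (\<lambda>(i, j). incidence (cell_list K (d - 1) ! i) (cell_list K d ! j))"

definition laplacian :: "'a::linorder set set \<Rightarrow> int \<Rightarrow> real mat" where
  "laplacian K d = incidence_matrix K d * transpose_mat (incidence_matrix K d)"


section \<open>Discrete Morse functions\<close>

definition upper_exceptions :: "'a set set \<Rightarrow> ('a set \<Rightarrow> real) \<Rightarrow> 'a set \<Rightarrow> 'a set set" where
  "upper_exceptions K f \<sigma> = {\<tau> \<in> K. codim1_face \<sigma> \<tau> \<and> f \<tau> \<le> f \<sigma>}"

definition lower_exceptions :: "'a set set \<Rightarrow> ('a set \<Rightarrow> real) \<Rightarrow> 'a set \<Rightarrow> 'a set set" where
  "lower_exceptions K f \<sigma> = {\<tau> \<in> K. codim1_face \<tau> \<sigma> \<and> f \<tau> \<ge> f \<sigma>}"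

definition discrete_morse_functions :: "'a set set \<Rightarrow> ('a set \<Rightarrow> real) set" where
  "discrete_morse_functions K =
     {f \<in> K \<rightarrow>\<^sub>E UNIV. \<forall>\<sigma>\<in>K. card (lower_exceptions K f \<sigma>) \<le> 1 \<and> card (upper_exceptions K f \<sigma>) \<le> 1}"

definition critical_cells :: "'a set set \<Rightarrow> ('a set \<Rightarrow> real) \<Rightarrow> int \<Rightarrow> 'a set set" where
  "critical_cells K f p =
     {\<sigma> \<in> cells K p. lower_exceptions K f \<sigma> = {} \<and> upper_exceptions K f \<sigma> = {}}"

definition gradient :: "'a set set \<Rightarrow> ('a set \<Rightarrow> real) \<Rightarrow> ('a set \<times> 'a set) set" where
  "gradient K f = {(\<sigma>, \<tau>). \<sigma> \<in> K \<and> \<tau> \<in> K \<and> codim1_face \<sigma> \<tau> \<and> f \<tau> \<le> f \<sigma>}"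

definition morse_equiv :: "'a set set \<Rightarrow> (('a set \<Rightarrow> real) \<times> ('a set \<Rightarrow> real)) set" where
  "morse_equiv K =
     {(f, g). f \<in> discrete_morse_functions K \<and> g \<in> discrete_morse_functions K \<and>
              gradient K f = gradient K g}"

definition morse_classes :: "'a set set \<Rightarrow> ('a set \<Rightarrow> real) set set" where
  "morse_classes K = discrete_morse_functions K // morse_equiv K"

text \<open>The critical cells of \<open>f\<close> depend only on the gradient of \<open>f\<close>, so it does not matter which
  representative of the class is considered. The index \<open>l\<close> is an integer; there are no classes
  for negative \<open>l\<close>. For \<open>d \<ge> 1\<close> the condition on \<open>p < d - 1\<close> includes \<open>p = -1\<close>: the empty cell
  must be critical, so that these classes are the ones obtained when the empty set is not
  counted as a cell.\<close>

definition morse_classes_with ::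
    "'a set set \<Rightarrow> int \<Rightarrow> int \<Rightarrow> ('a set \<Rightarrow> real) set set" where
  "morse_classes_with K d l =
     {C \<in> morse_classes K. \<exists>f\<in>C. int (card (critical_cells K f d)) = l \<and>
        (\<forall>p<d - 1. card (critical_cells K f p) = card (cells K p))}"


section \<open>Orientable manifolds\<close>

definition topological_manifold :: "nat \<Rightarrow> 'b topology \<Rightarrow> bool" where
  "topological_manifold n X \<longleftrightarrow>
     Hausdorff_space X \<and> second_countable X \<and>
     (\<forall>x\<in>topspace X. \<exists>U V. openin X U \<and> x \<in> U \<and> openin (Euclidean_space n) V \<and>
        subtopology X U homeomorphic_space subtopology (Euclidean_space n) V)"

text \<open>Orientations in terms of local homology: a choice of a generator of the infinite cyclic
  group $H_n(X, X - x)$ for every point $x$ that is locally induced by a single class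
  in $H_n(X, X - U)$.\<close>

abbreviation local_homology :: "nat \<Rightarrow> 'b topology \<Rightarrow> 'b set \<Rightarrow> 'b chain set monoid" where
  "local_homology n X U \<equiv> relative_homology_group (int n) X (topspace X - U)"

definition orientation :: "nat \<Rightarrow> 'b topology \<Rightarrow> ('b \<Rightarrow> 'b chain set) \<Rightarrow> bool" where
  "orientation n X \<mu> \<longleftrightarrow>
     (\<forall>x\<in>topspace X. \<mu> x \<in> carrier (local_homology n X {x}) \<and>
        subgroup_generated (local_homology n X {x}) {\<mu> x} = local_homology n X {x}) \<and>
     (\<forall>x\<in>topspace X. \<exists>U. openin X U \<and> x \<in> U \<and>
        (\<exists>\<alpha>\<in>carrier (local_homology n X U). \<forall>y\<in>U.
           \<mu> y = hom_induced (int n) X (topspace X - U) X (topspace X - {y}) id \<alpha>))"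

definition orientable_manifold :: "nat \<Rightarrow> 'b topology \<Rightarrow> bool" where
  "orientable_manifold n X \<longleftrightarrow> topological_manifold n X \<and> (\<exists>\<mu>. orientation n X \<mu>)"

end

theory Submission
  imports Defs
begin

text \<open>
  Write \<open>B\<close> for the incidence matrix. Expanding \<open>det (B B\<^sup>T + \<lambda> I)\<close> multilinearly in its rows, where row
  \<open>r\<close> is \<open>(\<Sum>f. B r f B\<^sub>f) + \<lambda> e\<^sub>r\<close>, gives one determinant for every map from the ridges to the facets
  together with a symbol for ``unpaired''. It vanishes unless the map pairs distinct ridges with distinct
  cofaces. If the pairing is the gradient of a discrete Morse function \<open>F\<close>, then \<open>F\<close> makes the matrix
  triangular and the determinant is the power of \<open>\<lambda>\<close> counting the unpaired ridges. Otherwise the pairing has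
  a closed path, and a coherent orientation of the facets supplies a kernel vector supported on it.

  The coherent orientation is extracted from local homology. The singular simplex of a facet \<open>f\<close> has infinite
  order in the local homology at every interior point of \<open>f\<close>, so it is a nonzero multiple \<open>\<kappa> f\<close> of the given
  orientation there. For two cofaces \<open>f\<close>, \<open>g\<close> of a ridge \<open>r\<close>, the difference of their simplices, signed so that
  \<open>r\<close> cancels from the boundary, is a cycle relative to the complement of the open star of \<open>r\<close>. Its
  multiplicity with respect to the orientation is locally constant near \<open>r\<close>, which compares \<open>\<kappa> f\<close> with \<open>\<kappa> g\<close>
  and excludes a third coface, near which the multiplicity would be zero.
\<close>

section \<open>Cells as singular simplices\<close>

lemma homologous_rel_set_int_pow:
  assumes "singular_relcycle p X S c"
  shows "homologous_rel_set p X S c [^]\<^bsub>relative_homology_group (int p) X S\<^esub> (k::int)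
       = homologous_rel_set p X S (frag_cmul k c)"
proof -
  have ch: "singular_chain p X c"
    using assms by (simp add: singular_relcycle)
  have "c \<in> carrier (subgroup_generated (free_Abelian_group (singular_simplex_set p X))
                        (singular_relcycle_set p X S))"
    by (metis assms carrier_relcycle_group chain_group_def mem_Collect_eq relcycle_group_def)
  then have "c [^]\<^bsub>relcycle_group p X S\<^esub> k = frag_cmul k c"
    using ch by (simp add: relcycle_group_def chain_group_def group.int_pow_subgroup_generated singular_chain_def)
  then show ?thesis
    using assms normal.FactGroup_int_pow[OF normal_subgroup_singular_relboundary_relcycle, of c p X S k]
    by (simp add: right_coset_singular_relboundary relative_homology_group_def)
qed

text \<open>Excising the complement of \<open>C\<close> gives an isomorphism, in particular an
  injection: a class that dies in \<open>X\<close> already dies in \<open>C\<close>. The open set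
  \<open>W\<close> between \<open>y\<close> and \<open>C\<close> provides the excision condition,
  that the closure of the excised set lies in the interior of the complement of
  \<open>y\<close>.\<close>

lemma excision_relboundary:
  assumes "C \<subseteq> topspace X" "openin X W" "W \<subseteq> C" "y \<in> W" "closedin X {y}"
    and c: "singular_relcycle p (subtopology X C) (C - {y}) c"
    and b: "singular_relboundary p X (topspace X - {y}) c"
  shows "singular_relboundary p (subtopology X C) (C - {y}) c"
proof -
  let ?U = "topspace X - C" and ?T = "topspace X - {y}" and ?S = "topspace X"
  have "X closure_of ?U \<subseteq> topspace X - W"
    using assms by (intro closure_of_minimal) (auto simp: openin_closedin_eq)
  also have "\<dots> \<subseteq> X interior_of ?T"
    using assms interior_of_openin[of X ?T] by (auto simp: openin_diff)
  finally have iso: "hom_induced p (subtopology X (?S - ?U)) (?T - ?U) (subtopology X ?S) ?T id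
    \<in> iso (relative_homology_group p (subtopology X (?S - ?U)) (?T - ?U))
          (relative_homology_group p (subtopology X ?S) ?T)"
    by (intro homology_excision_axiom) auto
  have eq: "?S - ?U = C" "?T - ?U = C - {y}"
    using assms by auto
  let ?h = "hom_induced p (subtopology X C) (C - {y}) X ?T id"
  have inj: "inj_on ?h (carrier (relative_homology_group p (subtopology X C) (C - {y})))"
    using iso by (simp add: eq iso_def bij_betw_def)
  have ind: "?h (homologous_rel_set p (subtopology X C) (C - {y}) z) = homologous_rel_set p X ?T z"
    if z: "singular_relcycle p (subtopology X C) (C - {y}) z" for z
  proof -
    have "singular_chain p (subtopology X C) z" 
      using z by (simp add: singular_relcycle)
    then have "chain_map p id z = z" 
      using chain_map_ident by blast
    then show ?thesis
      using hom_induced_chain_map[OF _ _ z, of X id ?T] assms(1) by (force simp: continuous_map_from_subtopology)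
  qed
  have "?h (homologous_rel_set p (subtopology X C) (C - {y}) c) = ?h (homologous_rel_set p (subtopology X C) (C - {y}) 0)"
    using b by (simp add: ind c homologous_rel_set_eq) (simp add: homologous_rel_def)
  then have "homologous_rel_set p (subtopology X C) (C - {y}) c = homologous_rel_set p (subtopology X C) (C - {y}) 0"
    using inj c by (auto simp: inj_on_def carrier_relative_homology_group)
  then show ?thesis
    by (simp add: homologous_rel_set_eq) (simp add: homologous_rel_def)
qed

section \<open>The geometric realization and the singular simplices of its cells\<close>

definition realization_carrier :: "'a set set \<Rightarrow> ('a \<Rightarrow> real) set" where
  "realization_carrier K = {x. (\<forall>v. 0 \<le> x v) \<and> {v. x v \<noteq> 0} \<in> K \<and> (\<Sum>v\<in>{v. x v \<noteq> 0}. x v) = 1}"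

lemma geometric_realization_eq:
  "geometric_realization K = subtopology (powertop_real UNIV) (realization_carrier K)"
  by (simp add: geometric_realization_def realization_carrier_def)

lemma topspace_geometric_realization [simp]:
  "topspace (geometric_realization K) = realization_carrier K"
  by (simp add: geometric_realization_eq)

lemma Hausdorff_geometric_realization: "Hausdorff_space (geometric_realization K)"
  unfolding geometric_realization_eq
  by (intro Hausdorff_space_subtopology) (simp add: Hausdorff_space_product_topology)

text \<open>The affine singular simplex onto the closed cell. Listing the vertices in increasing
  order makes its \<open>k\<close>-th face omit the \<open>k\<close>-th vertex in that order, so
  that the signs of the singular boundary are those of \<open>incidence\<close>.\<close>

definition cell_simplex :: "'a::linorder set \<Rightarrow> (nat \<Rightarrow> real) \<Rightarrow> 'a \<Rightarrow> real" where
  "cell_simplex \<sigma> = oriented_simplex (card \<sigma> - 1) (\<lambda>j v. if v = sorted_list_of_set \<sigma> ! j then 1 else 0)"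

lemma cell_simplex_vertex:
  assumes "finite \<sigma>" "card \<sigma> = Suc p" "x \<in> standard_simplex p" "i \<le> p"
  shows "cell_simplex \<sigma> x (sorted_list_of_set \<sigma> ! i) = x i"
proof -
  have "(if sorted_list_of_set \<sigma> ! i = sorted_list_of_set \<sigma> ! j then 1 else 0) * x j = (if j = i then x j else 0)"
    if "j \<le> p" for j
    using that assms by (auto simp: nth_eq_iff_index_eq)
  then have "cell_simplex \<sigma> x (sorted_list_of_set \<sigma> ! i) = (\<Sum>j\<le>p. if j = i then x j else 0)"
    unfolding cell_simplex_def oriented_simplex_def using assms by simp
  also have "\<dots> = x i" using assms by simp
  finally show ?thesis .
qed

lemma cell_simplex_outside:
  assumes "finite \<sigma>" "card \<sigma> = Suc p" "x \<in> standard_simplex p" "v \<notin> \<sigma>"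
  shows "cell_simplex \<sigma> x v = 0"
proof -
  have "v \<noteq> sorted_list_of_set \<sigma> ! j" if "j \<le> p" for j
    using that assms nth_mem[of j "sorted_list_of_set \<sigma>"] by auto
  then show ?thesis
    unfolding cell_simplex_def oriented_simplex_def using assms by simp
qed

lemma sorted_list_of_set_indices:
  assumes "finite \<sigma>" "card \<sigma> = Suc p"
  shows "\<sigma> = (\<lambda>i. sorted_list_of_set \<sigma> ! i) ` {..p}" "inj_on (\<lambda>i. sorted_list_of_set \<sigma> ! i) {..p}"
proof -
  have "\<sigma> = (\<lambda>i. sorted_list_of_set \<sigma> ! i) ` {..<card \<sigma>}"
    using assms(1) by (metis length_sorted_list_of_set lessThan_atLeast0 list.set_map map_nth set_sorted_list_of_set set_upt)
  then show "\<sigma> = (\<lambda>i. sorted_list_of_set \<sigma> ! i) ` {..p}"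
    using assms by (simp add: lessThan_Suc_atMost)
  show "inj_on (\<lambda>i. sorted_list_of_set \<sigma> ! i) {..p}"
    using assms by (auto simp: inj_on_def nth_eq_iff_index_eq)
qed

lemma cell_simplex_in_realization:
  assumes "finite \<sigma>" "card \<sigma> = Suc p" "x \<in> standard_simplex p" "Pow \<sigma> \<subseteq> K"
  shows "cell_simplex \<sigma> x \<in> realization_carrier K"
proof -
  let ?e = "cell_simplex \<sigma> x" and ?s = "\<lambda>i. sorted_list_of_set \<sigma> ! i"
  note s = sorted_list_of_set_indices[OF assms(1,2)]
  have sub: "{v. ?e v \<noteq> 0} \<subseteq> \<sigma>"
    using cell_simplex_outside[OF assms(1-3)] by blast
  have nn: "0 \<le> ?e v" for v
  proof (cases "v \<in> \<sigma>")
    case True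
    then obtain i where "i \<le> p" "v = ?s i" using s(1) by auto
    then show ?thesis using cell_simplex_vertex[OF assms(1-3)] assms(3) by (auto simp: standard_simplex_def)
  qed (use cell_simplex_outside[OF assms(1-3)] in auto)
  have "(\<Sum>v\<in>{v. ?e v \<noteq> 0}. ?e v) = (\<Sum>v\<in>\<sigma>. ?e v)"
    using sub assms(1) by (intro sum.mono_neutral_left) auto
  also have "\<dots> = (\<Sum>i\<le>p. ?e (?s i))"
    using s by (metis sum.reindex_cong)
  also have "\<dots> = (\<Sum>i\<le>p. x i)"
    using cell_simplex_vertex[OF assms(1-3)] by (intro sum.cong) auto
  also have "\<dots> = 1"
    using assms(3) by (simp add: standard_simplex_def)
  finally show ?thesis
    using nn sub assms(4) by (auto simp: realization_carrier_def)
qed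

lemma singular_simplex_cell_simplex:
  assumes "finite \<sigma>" "card \<sigma> = Suc p" "Pow \<sigma> \<subseteq> K"
  shows "singular_simplex p (geometric_realization K) (cell_simplex \<sigma>)"
proof -
  have "simplicial_simplex p (realization_carrier K) (cell_simplex \<sigma>)"
    unfolding simplicial_simplex
    using cell_simplex_in_realization[OF assms(1,2) _ assms(3)] assms(2)
    by (auto simp: cell_simplex_def)
  then show ?thesis
    by (simp add: geometric_realization_eq simplicial_imp_singular_simplex)
qed

lemma sorted_list_of_set_Diff_nth:
  assumes "finite \<sigma>" "k < card \<sigma>"
  shows "sorted_list_of_set (\<sigma> - {sorted_list_of_set \<sigma> ! k}) =
         take k (sorted_list_of_set \<sigma>) @ drop (Suc k) (sorted_list_of_set \<sigma>)"
proof -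
  let ?s = "sorted_list_of_set \<sigma>"
  have id: "?s = take k ?s @ ?s ! k # drop (Suc k) ?s"
    using assms by (simp add: id_take_nth_drop)
  then have d: "distinct (take k ?s @ ?s ! k # drop (Suc k) ?s)"
    using assms by (metis distinct_sorted_list_of_set)
  have "sorted_list_of_set (\<sigma> - {?s ! k}) = remove1 (?s ! k) ?s"
    using assms by (simp add: sorted_list_of_set_remove)
  also have "\<dots> = remove1 (?s ! k) (take k ?s @ ?s ! k # drop (Suc k) ?s)"
    using id by simp
  also have "\<dots> = take k ?s @ drop (Suc k) ?s"
    using d by (simp add: remove1_append)
  finally show ?thesis .
qed

lemma singular_face_cell_simplex:
  assumes "finite \<sigma>" "card \<sigma> = Suc p" "1 \<le> p" "k \<le> p"
  shows "singular_face p k (cell_simplex \<sigma>) = cell_simplex (\<sigma> - {sorted_list_of_set \<sigma> ! k})"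
proof -
  let ?s = "sorted_list_of_set \<sigma>"
  have mem: "?s ! k \<in> \<sigma>" using assms nth_mem[of k ?s] by auto
  then have c: "card (\<sigma> - {?s ! k}) - 1 = p - 1"
    using assms by simp
  have n: "sorted_list_of_set (\<sigma> - {?s ! k}) ! j = (if j < k then ?s ! j else ?s ! Suc j)"
    if "j \<le> p - 1" for j
    using that assms by (auto simp: sorted_list_of_set_Diff_nth nth_append)
  show ?thesis
    unfolding cell_simplex_def c
    using assms n by (auto simp: singular_face_oriented_simplex oriented_simplex_eq)
qed

section \<open>Infinite order of a simplex in the local homology at an interior point\<close>

abbreviation simplex_top :: "nat \<Rightarrow> (nat \<Rightarrow> real) topology" where
  "simplex_top p \<equiv> subtopology (powertop_real UNIV) (standard_simplex p)"

text \<open>A predicate in \<open>p\<close>, so that the transfer to cells of arbitrary complexes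
  can be proved from it and then used inside the induction that establishes it.\<close>

definition simplex_infinite_order :: "nat \<Rightarrow> bool" where
  "simplex_infinite_order p \<longleftrightarrow>
     (\<forall>y k. y \<in> standard_simplex p \<longrightarrow> (\<forall>i\<le>p. 0 < y i) \<longrightarrow>
        singular_relboundary p (simplex_top p) (standard_simplex p - {y})
          (frag_cmul k (frag_of (restrict id (standard_simplex p)))) \<longrightarrow> k = 0)"

lemma chain_boundary_cell_simplex:
  assumes "finite \<sigma>" "card \<sigma> = Suc p" "1 \<le> p"
  shows "chain_boundary p (frag_of (cell_simplex \<sigma>)) =
    (\<Sum>k\<le>p. frag_cmul ((-1) ^ k) (frag_of (cell_simplex (\<sigma> - {sorted_list_of_set \<sigma> ! k}))))"
  using assms by (simp add: chain_boundary_of singular_face_cell_simplex)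

lemma singular_chain_cell_simplex_within:
  assumes "finite \<sigma>" "card \<sigma> = Suc p" "Pow \<sigma> \<subseteq> K" 
    and "\<And>x. x \<in> realization_carrier K \<Longrightarrow> (\<And>v. v \<notin> \<sigma> \<Longrightarrow> x v = 0) \<Longrightarrow> x \<in> S"
  shows "singular_chain p (subtopology (geometric_realization K) S) (frag_of (cell_simplex \<sigma>))"
  using singular_simplex_cell_simplex[OF assms(1-3)] assms(4)
    cell_simplex_in_realization[OF assms(1,2) _ assms(3)] cell_simplex_outside[OF assms(1,2)]
  by (auto simp: singular_chain_of singular_simplex_subtopology)

text \<open>Each face of the simplex omits a vertex of \<open>\<sigma>\<close>, and that barycentric
  coordinate vanishes on it. In dimension 0 the boundary is 0 by definition.\<close>

lemma singular_chain_boundary_cell_simplex: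
  assumes "finite \<sigma>" "card \<sigma> = Suc p" "Pow \<sigma> \<subseteq> K" "{x \<in> realization_carrier K. \<exists>v\<in>\<sigma>. x v = 0} \<subseteq> S"
  shows "singular_chain (p - 1) (subtopology (geometric_realization K) S)
           (chain_boundary p (frag_of (cell_simplex \<sigma>)))"
proof (cases "p = 0")
  case True then show ?thesis by (simp add: chain_boundary_def)
next
  case False
  have "singular_chain (p - 1) (subtopology (geometric_realization K) S)
          (frag_of (cell_simplex (\<sigma> - {sorted_list_of_set \<sigma> ! k})))" if "k \<le> p" for k
  proof (rule singular_chain_cell_simplex_within)
    have mem: "sorted_list_of_set \<sigma> ! k \<in> \<sigma>" using that assms nth_mem[of k "sorted_list_of_set \<sigma>"] by auto
    then show "card (\<sigma> - {sorted_list_of_set \<sigma> ! k}) = Suc (p - 1)" using assms False by simp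
    show "\<And>x. x \<in> realization_carrier K \<Longrightarrow> (\<And>v. v \<notin> \<sigma> - {sorted_list_of_set \<sigma> ! k} \<Longrightarrow> x v = 0) \<Longrightarrow> x \<in> S"
      using mem assms(4) by auto
  qed (use assms in auto)
  then show ?thesis
    using assms False by (auto simp: chain_boundary_cell_simplex intro!: singular_chain_sum singular_chain_cmul)
qed

text \<open>For a cell \<open>\<sigma>\<close> this set is its open star; it is cut out by finitely
  many strict inequalities on continuous coordinates.\<close>

lemma openin_realization_positive:
  assumes "finite \<sigma>"
  shows "openin (geometric_realization K) {x \<in> realization_carrier K. \<forall>v\<in>\<sigma>. 0 < x v}"
proof -
  have cont: "continuous_map (geometric_realization K) euclideanreal (\<lambda>x. x v)" for v
    unfolding geometric_realization_eq by (intro continuous_map_from_subtopology continuous_map_product_projection) auto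
  have *: "openin (geometric_realization K) {x \<in> topspace (geometric_realization K). x v \<in> {0<..}}" for v
    by (rule openin_continuous_map_preimage[OF cont]) auto
  have "openin (geometric_realization K) (realization_carrier K \<inter> (\<Inter>v\<in>\<sigma>. {x \<in> topspace (geometric_realization K). x v \<in> {0<..}}))"
  proof (cases "\<sigma> = {}")
    case True
    then show ?thesis using openin_topspace[of "geometric_realization K"] by simp
  next
    case False
    then show ?thesis
      using assms * openin_topspace[of "geometric_realization K"] by (intro openin_Int openin_INT2) auto
  qed
  moreover have "(realization_carrier K \<inter> (\<Inter>v\<in>\<sigma>. {x \<in> topspace (geometric_realization K). x v \<in> {0<..}})) = {x \<in> realization_carrier K. \<forall>v\<in>\<sigma>. 0 < x v}"
    by auto
  ultimately show ?thesis by simp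
qed

text \<open>As \<open>\<sigma>\<close> is maximal, its open star lies in the closed cell, so
  excision moves the relation into the closed cell. The barycentric coordinates then carry it to the
  standard simplex, where the simplex of \<open>\<sigma>\<close> becomes the identity.\<close>

lemma cell_simplex_infinite_order_step:
  fixes \<sigma> :: "'a::linorder set"
  assumes si: "simplex_infinite_order p"
    and \<sigma>: "finite \<sigma>" "card \<sigma> = Suc p" "Pow \<sigma> \<subseteq> K"
    and max: "\<And>\<tau>. \<tau> \<in> K \<Longrightarrow> \<sigma> \<subseteq> \<tau> \<Longrightarrow> \<tau> = \<sigma>"
    and y: "y \<in> realization_carrier K" "\<And>v. v \<in> \<sigma> \<Longrightarrow> 0 < y v"
    and b: "singular_relboundary p (geometric_realization K) (realization_carrier K - {y})
              (frag_cmul k (frag_of (cell_simplex \<sigma>)))"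
  shows "k = 0"
proof -
  let ?X = "geometric_realization K" and ?s = "\<lambda>i. sorted_list_of_set \<sigma> ! i"
  note s = sorted_list_of_set_indices[OF \<sigma>(1,2)]
  \<comment> \<open>\<open>C\<close> is the closed cell, \<open>W\<close> the open star, and
    \<open>\<rho>\<close> reads off the coordinates in the order of the vertices.\<close>
  define C where "C = {x \<in> realization_carrier K. \<forall>v. v \<notin> \<sigma> \<longrightarrow> x v = 0}"
  define W where "W = {x \<in> realization_carrier K. \<forall>v\<in>\<sigma>. 0 < x v}"
  define \<rho> where "\<rho> x = (\<lambda>i. if i \<le> p then x (?s i) else 0 :: real)" for x :: "'a \<Rightarrow> real"
  have WC: "W \<subseteq> C"
  proof
    fix x assume x: "x \<in> W"
    then have "{v. x v \<noteq> 0} \<in> K" by (simp add: W_def realization_carrier_def)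
    moreover have "\<sigma> \<subseteq> {v. x v \<noteq> 0}" using x by (force simp: W_def)
    ultimately have "{v. x v \<noteq> 0} = \<sigma>"
      by (rule max)
    then show "x \<in> C" using x by (auto simp: C_def W_def)
  qed
  have yW: "y \<in> W" using y by (auto simp: W_def)
  have yC: "y \<in> C" using yW WC by auto
  have oW: "openin ?X W" unfolding W_def using \<sigma>(1) by (rule openin_realization_positive)
  have rc: "singular_relcycle p (subtopology ?X C) (C - {y}) (frag_cmul k (frag_of (cell_simplex \<sigma>)))"
  proof (rule singular_relcycle_cmul)
    have 1: "singular_chain p (subtopology ?X C) (frag_of (cell_simplex \<sigma>))"
      by (rule singular_chain_cell_simplex_within[OF \<sigma>]) (auto simp: C_def)
    have "singular_chain (p - 1) (subtopology ?X (realization_carrier K - {y})) (chain_boundary p (frag_of (cell_simplex \<sigma>)))"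
      using y by (intro singular_chain_boundary_cell_simplex[OF \<sigma>]) force
    with singular_chain_boundary[OF 1]
    have "singular_chain (p - 1) (subtopology ?X (C - {y})) (chain_boundary p (frag_of (cell_simplex \<sigma>)))"
      by (auto simp: singular_chain_subtopology subset_iff)
    then have 2: "singular_chain (p - 1) (subtopology (subtopology ?X C) (C - {y})) (chain_boundary p (frag_of (cell_simplex \<sigma>)))"
      by (simp add: subtopology_subtopology Int_absorb1)
    show "singular_relcycle p (subtopology ?X C) (C - {y}) (frag_of (cell_simplex \<sigma>))"
      using 1 2 by (simp add: singular_relcycle)
  qed
  have cl: "closedin ?X {y}"
    by (simp add: closedin_Hausdorff_sing_eq Hausdorff_geometric_realization y)
  have b': "singular_relboundary p (subtopology ?X C) (C - {y}) (frag_cmul k (frag_of (cell_simplex \<sigma>)))"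
    by (rule excision_relboundary[OF _ oW WC yW cl rc]) (use b in \<open>auto simp: C_def\<close>)
  have \<rho>s: "\<rho> x \<in> standard_simplex p" if x: "x \<in> C" for x
  proof -
    have nn: "\<And>v. 0 \<le> x v" and 1: "(\<Sum>v\<in>{v. x v \<noteq> 0}. x v) = 1"
      using x by (auto simp: C_def realization_carrier_def)
    have "(\<Sum>v\<in>{v. x v \<noteq> 0}. x v) = (\<Sum>v\<in>\<sigma>. x v)"
      using x \<sigma>(1) by (intro sum.mono_neutral_left) (auto simp: C_def)
    also have "\<dots> = (\<Sum>i\<le>p. x (?s i))" using s by (metis sum.reindex_cong)
    finally have sum1: "(\<Sum>i\<le>p. x (?s i)) = 1" using 1 by simp
    have "x (?s i) \<le> 1" if "i \<le> p" for i
      using member_le_sum[of i "{..p}" "\<lambda>i. x (?s i)"] sum1 nn that by simp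
    then show ?thesis using nn sum1 by (auto simp: standard_simplex_def \<rho>_def)
  qed
  have cont: "continuous_map (subtopology ?X C) (simplex_top p) \<rho>"
  proof -
    have "continuous_map (subtopology ?X C) euclideanreal (\<lambda>x. \<rho> x i)" for i
      unfolding geometric_realization_eq \<rho>_def
      by (cases "i \<le> p") (auto intro!: continuous_map_from_subtopology continuous_map_product_projection)
    then show ?thesis
      using \<rho>s by (auto simp: continuous_map_in_subtopology continuous_map_componentwise_UNIV)
  qed
  \<comment> \<open>Only \<open>y\<close> has the image \<open>\<rho> y\<close>, so the complement
    of \<open>y\<close> is mapped into the complement of \<open>\<rho> y\<close>.\<close>
  have inj: "x = y" if "x \<in> C" "\<rho> x = \<rho> y" for x
  proof
    fix v
    show "x v = y v"
    proof (cases "v \<in> \<sigma>")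
      case True
      then obtain i where "i \<le> p" "v = ?s i" using s(1) by auto
      then show ?thesis using fun_cong[OF that(2), of i] by (simp add: \<rho>_def)
    qed (use that(1) yC in \<open>auto simp: C_def\<close>)
  qed
  have sm: "simplex_map p \<rho> (cell_simplex \<sigma>) = restrict id (standard_simplex p)"
  proof -
    have "\<rho> (cell_simplex \<sigma> x) = x" if "x \<in> standard_simplex p" for x
      using that cell_simplex_vertex[OF \<sigma>(1,2) that] by (auto simp: \<rho>_def standard_simplex_def)
    then show ?thesis by (auto simp: simplex_map_def restrict_def)
  qed
  have "singular_relboundary p (simplex_top p) (standard_simplex p - {\<rho> y})
          (chain_map p \<rho> (frag_cmul k (frag_of (cell_simplex \<sigma>))))"
    by (rule singular_relboundary_chain_map[OF b' cont]) (use inj \<rho>s in blast)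
  then have "singular_relboundary p (simplex_top p) (standard_simplex p - {\<rho> y})
          (frag_cmul k (frag_of (restrict id (standard_simplex p))))"
    by (simp add: sm)
  moreover have "\<forall>i\<le>p. 0 < \<rho> y i"
    using y s(1) by (auto simp: \<rho>_def)
  ultimately show "k = 0"
    using si \<rho>s[OF yC] unfolding simplex_infinite_order_def by blast
qed

lemma sorted_list_of_set_atMost_nth: "i \<le> q \<Longrightarrow> sorted_list_of_set {..q} ! i = i"
proof -
  assume "i \<le> q"
  moreover have "{..q} = {0..<Suc q}" by auto
  ultimately show ?thesis by (simp only: sorted_list_of_set_range) (simp del: upt_Suc)
qed

text \<open>The identity of the standard simplex is itself the simplex of a cell, so the boundary
  formula for cells applies to it.\<close>

lemma cell_simplex_atMost: "cell_simplex {..q} = restrict id (standard_simplex q)"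
proof -
  have n: "sorted_list_of_set {..q} ! i = i" if "i \<le> q" for i
    using that by (rule sorted_list_of_set_atMost_nth)
  have "cell_simplex {..q} x v = x v" if x: "x \<in> standard_simplex q" for x v
  proof (cases "v \<le> q")
    case True
    then show ?thesis using cell_simplex_vertex[of "{..q}" q x v] x n by simp
  next
    case False
    then show ?thesis using cell_simplex_outside[of "{..q}" q x v] x by (simp add: standard_simplex_def)
  qed
  moreover have "cell_simplex {..q} x = undefined" if "x \<notin> standard_simplex q" for x
    using that by (simp add: cell_simplex_def oriented_simplex_def)
  ultimately show ?thesis by (intro ext) (simp add: restrict_def fun_eq_iff)
qed

lemma continuous_map_Max_atMost:
  assumes "\<And>i. i \<le> q \<Longrightarrow> continuous_map X euclideanreal (f i)"
  shows "continuous_map X euclideanreal (\<lambda>x. MAX i\<in>{..q::nat}. f i x)"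
  using assms
proof (induction q)
  case 0
  then show ?case by simp
next
  case (Suc q)
  have "(MAX i\<in>{..Suc q}. f i x) = max (f (Suc q) x) (MAX i\<in>{..q}. f i x)" for x
    by (simp add: atMost_Suc Max_insert)
  then show ?case using Suc by (simp add: continuous_map_real_max)
qed

text \<open>The radial projection from \<open>y\<close>: scaling \<open>x - y\<close> by \<open>1 / M x\<close> is what makes the first
  coordinate vanish.\<close>

lemma simplex_boundary_retraction:
  assumes y: "y \<in> standard_simplex q" "\<And>i. i \<le> q \<Longrightarrow> 0 < y i"
  obtains r where
    "continuous_map (subtopology (powertop_real UNIV) (standard_simplex q - {y}))
       (geometric_realization {s. s \<subset> {..q}}) r"
    "\<And>x. x \<in> realization_carrier {s. s \<subset> {..q}} \<Longrightarrow> r x = x"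
proof
  let ?K = "{s. s \<subset> {..q}}"
  let ?u = "\<lambda>i x. 1 - x i / y i"
  define M where "M x = (MAX i\<in>{..q}. ?u i x)" for x :: "nat \<Rightarrow> real"
  define r where "r x = (\<lambda>i. y i + (x i - y i) / M x)" for x :: "nat \<Rightarrow> real"
  have uM: "?u i x \<le> M x" if "i \<le> q" for i x
    unfolding M_def using that by (intro Max_ge) auto
  have att: "\<exists>i\<le>q. ?u i x = M x" for x
  proof -
    have "M x \<in> (\<lambda>i. ?u i x) ` {..q}" unfolding M_def by (intro Max_in) auto
    then show ?thesis by auto
  qed
  have Mpos: "0 < M x" if x: "x \<in> standard_simplex q" "x \<noteq> y" for x
  proof -
    obtain j where "x j \<noteq> y j" using x(2) by auto
    then have j: "j \<le> q" using x(1) y(1) by (cases "j \<le> q") (simp_all add: standard_simplex_def)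
    \<comment> \<open>Both points have coordinate sum 1, so if they differ, some coordinate of
      \<open>x\<close> is below that of \<open>y\<close>.\<close>
    have "\<exists>i\<le>q. x i < y i"
    proof (rule ccontr)
      assume "\<not> ?thesis"
      then have le: "\<And>i. i \<le> q \<Longrightarrow> y i \<le> x i" by (simp add: not_less)
      then have "y j < x j" using j \<open>x j \<noteq> y j\<close> by (simp add: order_less_le)
      then have "(\<Sum>i\<le>q. y i) < (\<Sum>i\<le>q. x i)"
        using le j by (intro sum_strict_mono_ex1) auto
      then show False using x(1) y(1) by (simp add: standard_simplex_def)
    qed
    then obtain i where i: "i \<le> q" "x i < y i" by auto
    then have "0 < ?u i x" using y(2)[of i] by simp
    then show ?thesis using uM[OF i(1), of x] by linarith
  qed
  have rin: "r x \<in> realization_carrier ?K" if x: "x \<in> standard_simplex q" "x \<noteq> y" for x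
  proof -
    note M = Mpos[OF x]
    \<comment> \<open>In this form the coordinate is nonnegative, since the quotient is at most 1,
      and it vanishes where the maximum is attained. Hence the support is a proper subset.\<close>
    have req: "r x i = y i * (1 - ?u i x / M x)" if "i \<le> q" for i
      using y(2)[OF that] M by (simp add: r_def field_simps)
    have r0: "r x i = 0" if "\<not> i \<le> q" for i
      using that x(1) y(1) by (simp add: r_def standard_simplex_def)
    have nn: "0 \<le> r x i" for i
    proof (cases "i \<le> q")
      case True
      have "?u i x / M x \<le> 1" using uM[OF True, of x] M by simp
      then show ?thesis using req[OF True] y(2)[OF True] by simp
    qed (simp add: r0)
    obtain i where i: "i \<le> q" "?u i x = M x" using att by blast
    then have "r x i = 0" using req[OF i(1)] M by simp
    then have supp: "{v. r x v \<noteq> 0} \<subset> {..q}" using r0 i(1) by auto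
    have "(\<Sum>v\<in>{v. r x v \<noteq> 0}. r x v) = (\<Sum>v\<le>q. r x v)"
      using supp by (intro sum.mono_neutral_left) auto
    also have "\<dots> = (\<Sum>v\<le>q. y v) + ((\<Sum>v\<le>q. x v) - (\<Sum>v\<le>q. y v)) / M x"
      by (simp add: r_def sum.distrib sum_subtractf flip: sum_divide_distrib)
    also have "\<dots> = 1" using x(1) y(1) by (simp add: standard_simplex_def)
    finally show ?thesis using nn supp by (simp add: realization_carrier_def)
  qed
  have proj: "continuous_map (subtopology (powertop_real UNIV) (standard_simplex q - {y})) euclideanreal (\<lambda>x. x i)" for i
    by (intro continuous_map_from_subtopology continuous_map_product_projection) auto
  have "continuous_map (subtopology (powertop_real UNIV) (standard_simplex q - {y})) euclideanreal M"
    unfolding M_def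
    by (intro continuous_map_Max_atMost continuous_map_real_divide continuous_map_diff proj)
       (use y(2) in \<open>force+\<close>)
  then have "continuous_map (subtopology (powertop_real UNIV) (standard_simplex q - {y})) euclideanreal (\<lambda>x. r x i)" for i
    unfolding r_def
    by (intro continuous_map_add continuous_map_real_divide continuous_map_diff proj) (auto dest: Mpos)
  then show "continuous_map (subtopology (powertop_real UNIV) (standard_simplex q - {y})) (geometric_realization ?K) r"
    using rin by (auto simp: geometric_realization_eq continuous_map_in_subtopology continuous_map_componentwise_UNIV)
  show "r x = x" if x: "x \<in> realization_carrier ?K" for x
  proof -
    have nn: "\<And>v. 0 \<le> x v" and s: "{v. x v \<noteq> 0} \<subset> {..q}"
      using x by (auto simp: realization_carrier_def)
    \<comment> \<open>On the boundary a vanishing coordinate forces \<open>M x = 1\<close>, so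
      nothing is scaled.\<close>
    then obtain j where j: "j \<le> q" "x j = 0" by auto
    have "?u i x \<le> 1" if "i \<le> q" for i using nn[of i] y(2)[OF that] by simp
    then have "M x \<le> 1" using att[of x] by force
    moreover have "1 \<le> M x" using uM[OF j(1), of x] j(2) by simp
    ultimately show ?thesis by (simp add: r_def)
  qed
qed

text \<open>A relative boundary at \<open>y\<close> has a boundary that bounds in the complement of \<open>y\<close>. The radial
  projection carries this to the boundary sphere, where a point inside the face opposite to the
  vertex \<open>0\<close> sees only that face.\<close>

lemma simplex_infinite_order: "simplex_infinite_order p"
proof (induction p)
  case 0
  show ?case
    unfolding simplex_infinite_order_def
  proof (intro allI impI)
    fix y :: "nat \<Rightarrow> real" and k
    assume y: "y \<in> standard_simplex 0"
      and b: "singular_relboundary 0 (simplex_top 0) (standard_simplex 0 - {y})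
               (frag_cmul k (frag_of (restrict id (standard_simplex 0))))"
    \<comment> \<open>The complement of \<open>y\<close> is empty here, and in a one-point space the
      only 0-boundary is 0.\<close>
    have s: "standard_simplex 0 = {y}" using y by (auto simp: standard_simplex_0)
    then show "k = 0"
      using b singular_boundary_singleton[of "simplex_top 0" y 0] by simp
  qed
next
  case (Suc p)
  show ?case
    unfolding simplex_infinite_order_def
  proof (intro allI impI)
    fix y :: "nat \<Rightarrow> real" and k
    let ?D = "standard_simplex (Suc p)" and ?K = "{s. s \<subset> {..Suc p}}"
    let ?c = "frag_cmul k (frag_of (restrict id ?D))" and ?X = "geometric_realization ?K"
    assume y: "y \<in> ?D" and pos: "\<forall>i\<le>Suc p. 0 < y i"
      and b: "singular_relboundary (Suc p) (simplex_top (Suc p)) (?D - {y}) ?c"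
    obtain d e where d: "singular_chain (Suc (Suc p)) (simplex_top (Suc p)) d"
      and e: "singular_chain (Suc p) (subtopology (simplex_top (Suc p)) (?D - {y})) e"
      and c: "chain_boundary (Suc (Suc p)) d + e = ?c"
      using b unfolding singular_relboundary by blast
    have bc: "chain_boundary (Suc p) ?c = chain_boundary (Suc p) e"
      using chain_boundary_boundary_alt[OF d] by (simp flip: c add: chain_boundary_add)
    have top: "subtopology (simplex_top (Suc p)) (?D - {y}) = subtopology (powertop_real UNIV) (?D - {y})"
      by (simp add: subtopology_subtopology Int_absorb1)
    have "singular_relboundary p (subtopology (powertop_real UNIV) (?D - {y})) {} (chain_boundary (Suc p) ?c)"
      using e unfolding singular_boundary bc top by blast
    moreover obtain r where r: "continuous_map (subtopology (powertop_real UNIV) (?D - {y})) ?X r"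
      and rid: "\<And>x. x \<in> realization_carrier ?K \<Longrightarrow> r x = x"
      using simplex_boundary_retraction y pos by metis
    ultimately have "singular_relboundary p ?X {} (chain_map p r (chain_boundary (Suc p) ?c))"
      by (intro singular_relboundary_chain_map) auto
    moreover define F where "F j = cell_simplex ({..Suc p} - {j})" for j
    have nth: "sorted_list_of_set {..Suc p} ! i = i" if "i \<le> Suc p" for i
      using that by (rule sorted_list_of_set_atMost_nth)
    have bF: "chain_boundary (Suc p) ?c = (\<Sum>j\<le>Suc p. frag_cmul (k * (-1) ^ j) (frag_of (F j)))"
      using nth by (simp add: chain_boundary_cmul chain_boundary_cell_simplex frag_cmul_sum F_def flip: cell_simplex_atMost
            del: sum.atMost_Suc)
    have sF: "singular_simplex p ?X (F j)" if "j \<le> Suc p" for j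
      unfolding F_def using that by (intro singular_simplex_cell_simplex) auto
    have "singular_chain p ?X (chain_boundary (Suc p) ?c)"
      unfolding bF using sF by (intro singular_chain_sum singular_chain_cmul) (simp add: singular_chain_of)
    then have "chain_map p r (chain_boundary (Suc p) ?c) = chain_boundary (Suc p) ?c"
      using rid by (intro chain_map_id_gen) auto
    ultimately have b0: "singular_relboundary p ?X {} (\<Sum>j\<le>Suc p. frag_cmul (k * (-1) ^ j) (frag_of (F j)))"
      using bF by simp
    \<comment> \<open>The barycenter of the face opposite to the vertex \<open>0\<close>.\<close>
    define z where "z = (\<lambda>i::nat. if i \<in> {1..Suc p} then 1 / real (Suc p) else 0)"
    have supp: "{v. z v \<noteq> 0} = {1..Suc p}" by (auto simp: z_def)
    have zK: "z \<in> realization_carrier ?K"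
    proof -
      have "0 \<in> {..Suc p}" "0 \<notin> {1..Suc p}" by simp_all
      then have "{1..Suc p} \<subset> {..Suc p}" by (metis atLeastAtMost_iff atMost_iff psubsetI subsetI)
      then show ?thesis
        unfolding realization_carrier_def mem_Collect_eq supp by (simp add: z_def)
    qed
    have zpos: "0 < z v" if "v \<in> {1..Suc p}" for v using that by (simp add: z_def)
    let ?S = "realization_carrier ?K - {z}"
    have b1: "singular_relboundary p ?X ?S (\<Sum>j\<le>Suc p. frag_cmul (k * (-1) ^ j) (frag_of (F j)))"
      using singular_relboundary_chain_map[OF b0, of ?X id ?S] 
      using b0 singular_boundary_imp_chain[OF b0] by (simp add: chain_map_ident)
    \<comment> \<open>The face \<open>F j\<close> omits the vertex \<open>j\<close>, while
      \<open>z j\<close> is positive; so it avoids \<open>z\<close>.\<close>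
    have b2: "singular_relboundary p ?X ?S (\<Sum>j\<in>{1..Suc p}. frag_cmul (k * (-1) ^ j) (frag_of (F j)))"
    proof (intro singular_chain_imp_relboundary singular_chain_sum singular_chain_cmul)
      fix j assume j: "j \<in> {1..Suc p}"
      show "singular_chain p (subtopology ?X ?S) (frag_of (F j))"
        unfolding F_def using j zpos[OF j] by (intro singular_chain_cell_simplex_within) force+
    qed
    have split: "{..Suc p} = insert 0 {1..Suc p}" by auto
    have "(\<Sum>j\<le>Suc p. frag_cmul (k * (-1) ^ j) (frag_of (F j))) =
       frag_cmul k (frag_of (F 0)) + (\<Sum>j\<in>{1..Suc p}. frag_cmul (k * (-1) ^ j) (frag_of (F j)))"
      by (subst split, subst sum.insert) auto
    then have "singular_relboundary p ?X ?S (frag_cmul k (frag_of (F 0)))"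
      using singular_relboundary_diff[OF b1 b2] by simp
    moreover have "F 0 = cell_simplex {1..Suc p}" by (simp add: F_def split)
    \<comment> \<open>In the boundary complex this face is maximal, as the transfer from dimension
      \<open>p\<close> requires.\<close>
    moreover have "\<tau> = {1..Suc p}" if "\<tau> \<in> ?K" "{1..Suc p} \<subseteq> \<tau>" for \<tau>
      using that unfolding split by blast
    moreover have "Pow {1..Suc p} \<subseteq> ?K"
      unfolding split by auto
    ultimately show "k = 0"
      by (intro cell_simplex_infinite_order_step[OF Suc.IH, of "{1..Suc p}" ?K z]) (use zK zpos in simp_all)
  qed
qed

lemmas cell_simplex_infinite_order = cell_simplex_infinite_order_step[OF simplex_infinite_order]

section \<open>Multiplicities with respect to an orientation\<close>

lemma singular_relcycle_mono:
  assumes "singular_relcycle p X S c" "S \<subseteq> T"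
  shows "singular_relcycle p X T c"
  using assms singular_chain_mono unfolding singular_relcycle by blast

text \<open>A chain in the complement of \<open>x\<close> has compact support, so it avoids a neighbourhood of \<open>x\<close>.\<close>

lemma singular_relboundary_avoiding:
  assumes b: "singular_relboundary p X (topspace X - {x}) c" and X: "Hausdorff_space X" and x: "x \<in> topspace X"
  shows "\<exists>W. openin X W \<and> x \<in> W \<and> (\<forall>y\<in>W. singular_relboundary p X (topspace X - {y}) c)"
proof -
  obtain w u where w: "singular_chain (Suc p) X w" 
    and u: "singular_chain p (subtopology X (topspace X - {x})) u" and c: "chain_boundary (Suc p) w + u = c"
    using b unfolding singular_relboundary by blast
  define C where "C = (\<Union>f\<in>Poly_Mapping.keys u. f ` standard_simplex p)"
  have "compactin X (f ` standard_simplex p)" if "f \<in> Poly_Mapping.keys u" for f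
  proof -
    have "continuous_map (simplex_top p) X f"
    proof -
      have "singular_chain p X u" using u unfolding singular_chain_subtopology by blast
      then show ?thesis using that unfolding singular_chain_def singular_simplex_def by blast
    qed
    then show ?thesis
      by (rule image_compactin[rotated]) (simp add: compactin_subtopology compactin_standard_simplex)
  qed
  then have "closedin X C"
    unfolding C_def using X by (intro closedin_Union) (auto intro: compactin_imp_closedin)
  moreover have "x \<notin> C"
    using u unfolding singular_chain_subtopology C_def by auto
  moreover have "singular_relboundary p X (topspace X - {y}) c" if y: "y \<in> topspace X - C" for y
  proof -
    have "f ` standard_simplex p \<subseteq> topspace X - {y}" if "f \<in> Poly_Mapping.keys u" for f
    proof -
      have "f ` standard_simplex p \<subseteq> topspace X" using u that unfolding singular_chain_subtopology by blast
      moreover have "f ` standard_simplex p \<subseteq> C" using that by (auto simp: C_def)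
      ultimately show ?thesis using y by blast
    qed
    then have "singular_chain p (subtopology X (topspace X - {y})) u"
      using u unfolding singular_chain_subtopology by blast
    then show ?thesis using w c unfolding singular_relboundary by blast
  qed
  ultimately show ?thesis
    using x by (intro exI[of _ "topspace X - C"]) (auto simp: openin_diff)
qed

lemma homologous_rel_cmul:
  "homologous_rel p Y S a b \<Longrightarrow> homologous_rel p Y S (frag_cmul k a) (frag_cmul k b)"
proof -
  assume "homologous_rel p Y S a b"
  then have "singular_relboundary p Y S (frag_cmul k (a - b))"
    unfolding homologous_rel_def by (rule singular_relboundary_cmul)
  moreover have "frag_cmul k (a - b) = frag_cmul k a - frag_cmul k b"
    using frag_cmul_distrib2[of k "a - b" b] by (simp add: algebra_simps)
  ultimately show ?thesis by (simp add: homologous_rel_def)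
qed

locale oriented_space =
  fixes d :: nat and X :: "'b topology" and \<mu> :: "'b \<Rightarrow> 'b chain set"
  assumes Hausdorff: "Hausdorff_space X" and orientation: "orientation d X \<mu>"
begin

text \<open>The class of \<open>z\<close> in the local homology at \<open>x\<close> is
  \<open>k\<close> times the orientation. Working with a chain \<open>m\<close> that represents
  \<open>\<mu> x\<close> avoids arithmetic in the quotient group. It is a relation, since uniqueness
  of \<open>k\<close> is a separate matter that rests on a class of infinite order.\<close>

definition has_multiplicity :: "'b chain \<Rightarrow> 'b \<Rightarrow> int \<Rightarrow> bool" where
  "has_multiplicity z x k \<longleftrightarrow>
     (\<exists>m. singular_relcycle d X (topspace X - {x}) m \<and>
          \<mu> x = homologous_rel_set d X (topspace X - {x}) m \<and>
          homologous_rel d X (topspace X - {x}) z (frag_cmul k m))"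

lemma orientation_chain:
  assumes "x \<in> topspace X"
  obtains m where "singular_relcycle d X (topspace X - {x}) m" "\<mu> x = homologous_rel_set d X (topspace X - {x}) m"
  using assms orientation unfolding orientation_def by (auto simp: carrier_relative_homology_group)

lemma has_multiplicity_iff:
  assumes "\<mu> x = homologous_rel_set d X (topspace X - {x}) m" "singular_relcycle d X (topspace X - {x}) m"
  shows "has_multiplicity z x k \<longleftrightarrow> homologous_rel d X (topspace X - {x}) z (frag_cmul k m)"
proof
  assume "has_multiplicity z x k"
  then obtain m' where m': "\<mu> x = homologous_rel_set d X (topspace X - {x}) m'"
     "homologous_rel d X (topspace X - {x}) z (frag_cmul k m')"
    unfolding has_multiplicity_def by blast
  have "homologous_rel d X (topspace X - {x}) m' m"
    using assms(1) m'(1) homologous_rel_set_eq by metis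
  then show "homologous_rel d X (topspace X - {x}) z (frag_cmul k m)"
    using homologous_rel_cmul m'(2) homologous_rel_trans by metis
qed (use assms in \<open>auto simp: has_multiplicity_def\<close>)

text \<open>The orientation generates the local homology, so the class of \<open>z\<close> is a
  power of \<open>\<mu> x\<close>, and powers are represented by multiples of the representing
  chain.\<close>

lemma has_multiplicity_exists:
  assumes "x \<in> topspace X" "singular_relcycle d X (topspace X - {x}) z"
  shows "\<exists>k. has_multiplicity z x k"
proof -
  obtain m where m: "singular_relcycle d X (topspace X - {x}) m" "\<mu> x = homologous_rel_set d X (topspace X - {x}) m"
    using orientation_chain assms(1) by blast
  let ?G = "local_homology d X {x}"
  have "subgroup_generated ?G {\<mu> x} = ?G" "\<mu> x \<in> carrier ?G"
    using orientation assms(1) unfolding orientation_def by auto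
  then have "carrier ?G = range (\<lambda>n::int. \<mu> x [^]\<^bsub>?G\<^esub> n)"
    using group.carrier_subgroup_generated_by_singleton[of ?G "\<mu> x"] by simp
  moreover have "homologous_rel_set d X (topspace X - {x}) z \<in> carrier ?G"
    using assms(2) by (auto simp: carrier_relative_homology_group)
  ultimately obtain k :: int where "homologous_rel_set d X (topspace X - {x}) z = \<mu> x [^]\<^bsub>?G\<^esub> k"
    by auto
  then have "homologous_rel_set d X (topspace X - {x}) z = homologous_rel_set d X (topspace X - {x}) (frag_cmul k m)"
    using homologous_rel_set_int_pow[OF m(1)] m(2) by simp
  then show ?thesis
    using has_multiplicity_iff[OF m(2,1)] by (auto simp: homologous_rel_set_eq)
qed

text \<open>Near \<open>x\<close> the orientation is represented by a single chain \<open>a\<close>.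
  The difference of \<open>z\<close> and \<open>k\<close> times \<open>a\<close> is a relative
  boundary at \<open>x\<close>, and it remains one at nearby points by compactness of
  supports.\<close>

lemma has_multiplicity_locally_constant:
  assumes z: "has_multiplicity z x k" and x: "x \<in> topspace X"
  shows "\<exists>W. openin X W \<and> x \<in> W \<and> (\<forall>y\<in>W. has_multiplicity z y k)"
proof -
  obtain U \<alpha> where U: "openin X U" "x \<in> U" and \<alpha>: "\<alpha> \<in> carrier (local_homology d X U)"
    and ind: "\<forall>y\<in>U. \<mu> y = hom_induced (int d) X (topspace X - U) X (topspace X - {y}) id \<alpha>"
  proof -
    have "\<exists>U. openin X U \<and> x \<in> U \<and> (\<exists>\<alpha>\<in>carrier (local_homology d X U). \<forall>y\<in>U.
           \<mu> y = hom_induced (int d) X (topspace X - U) X (topspace X - {y}) id \<alpha>)"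
      using orientation x unfolding orientation_def by (elim conjE) (erule bspec)
    then show thesis using that by (elim exE conjE bexE)
  qed
  obtain a where a: "singular_relcycle d X (topspace X - U) a" "\<alpha> = homologous_rel_set d X (topspace X - U) a"
    using \<alpha> by (auto simp: carrier_relative_homology_group)
  have rel: "singular_relcycle d X (topspace X - {y}) a" if "y \<in> U" for y
    by (rule singular_relcycle_mono[OF a(1)]) (use that in auto)
  have \<mu>: "\<mu> y = homologous_rel_set d X (topspace X - {y}) a" if y: "y \<in> U" for y
  proof -
    have "chain_map d id a = a"
      using a(1) chain_map_ident unfolding singular_relcycle by blast
    moreover have "id \<in> topspace X - U \<rightarrow> topspace X - {y}" using y by auto
    ultimately show ?thesis
      using hom_induced_chain_map[of X X id "topspace X - U" "topspace X - {y}" d a] a bspec[OF ind y] by simp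
  qed
  have "singular_relboundary d X (topspace X - {x}) (z - frag_cmul k a)"
    using z has_multiplicity_iff[OF \<mu> rel, OF U(2) U(2)] by (simp add: homologous_rel_def)
  from singular_relboundary_avoiding[OF this Hausdorff x]
  obtain W where W: "openin X W" "x \<in> W"
    and b: "\<forall>y\<in>W. singular_relboundary d X (topspace X - {y}) (z - frag_cmul k a)"
    by (elim exE conjE)
  have "has_multiplicity z y k" if y: "y \<in> U" "y \<in> W" for y
    using bspec[OF b y(2)] unfolding has_multiplicity_iff[OF \<mu>[OF y(1)] rel[OF y(1)]] homologous_rel_def .
  then show ?thesis
    using U W by (intro exI[of _ "U \<inter> W"] conjI openin_Int) simp_all
qed

text \<open>If \<open>s\<close> is \<open>j\<close> times the orientation, then \<open>k - l\<close>
  times \<open>s\<close> is homologous to \<open>j * (k - l)\<close> times \<open>m\<close>, which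
  is zero because the multiples of \<open>m\<close> by \<open>k\<close> and by \<open>l\<close> are
  homologous. The infinite order of \<open>s\<close> gives \<open>k = l\<close>.\<close>

lemma has_multiplicity_unique:
  assumes "has_multiplicity z x k" "has_multiplicity z x l" "x \<in> topspace X"
    and s: "singular_relcycle d X (topspace X - {x}) s"
    and inf: "\<And>k. singular_relboundary d X (topspace X - {x}) (frag_cmul k s) \<Longrightarrow> k = 0"
  shows "k = l"
proof -
  let ?S = "topspace X - {x}"
  obtain m where m: "singular_relcycle d X ?S m" "\<mu> x = homologous_rel_set d X ?S m"
    using orientation_chain assms(3) by blast
  note iff = has_multiplicity_iff[OF m(2,1)]
  obtain j where j: "homologous_rel d X ?S s (frag_cmul j m)"
    using has_multiplicity_exists[OF assms(3) s] iff by auto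
  have "homologous_rel d X ?S (z - z) (frag_cmul k m - frag_cmul l m)"
    using assms(1,2) iff by (intro homologous_rel_diff) auto
  then have "homologous_rel d X ?S 0 (frag_cmul (k - l) m)"
    by (simp add: frag_cmul_diff_distrib)
  then have 1: "homologous_rel d X ?S 0 (frag_cmul (j * (k - l)) m)"
    using homologous_rel_cmul[of d X ?S 0 "frag_cmul (k - l) m" j] by simp
  have 2: "homologous_rel d X ?S (frag_cmul (k - l) s) (frag_cmul (j * (k - l)) m)"
    using homologous_rel_cmul[OF j, of "k - l"] by (simp add: mult.commute)
  have "homologous_rel d X ?S (frag_cmul (k - l) s) 0"
    using 1 2 homologous_rel_trans homologous_rel_sym by metis
  then show ?thesis using inf[of "k - l"] by (simp add: homologous_rel_def)
qed

lemma has_multiplicity_lincomb: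
  assumes "has_multiplicity a x k" "has_multiplicity b x l"
  shows "has_multiplicity (frag_cmul i a + frag_cmul j b) x (i * k + j * l)"
proof -
  obtain m where m: "singular_relcycle d X (topspace X - {x}) m" "\<mu> x = homologous_rel_set d X (topspace X - {x}) m"
    using assms unfolding has_multiplicity_def by blast
  note iff = has_multiplicity_iff[OF m(2,1)]
  have "homologous_rel d X (topspace X - {x}) (frag_cmul i a + frag_cmul j b) (frag_cmul i (frag_cmul k m) + frag_cmul j (frag_cmul l m))"
    using assms iff by (intro homologous_rel_add homologous_rel_cmul) auto
  then show ?thesis using iff by (simp add: frag_cmul_distrib)
qed

lemma has_multiplicity_0:
  assumes "x \<in> topspace X" "singular_relboundary d X (topspace X - {x}) z"
  shows "has_multiplicity z x 0"
  using assms orientation_chain[OF assms(1)] unfolding has_multiplicity_def homologous_rel_def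
  by (metis diff_zero frag_cmul_zero)

text \<open>The set of times with multiplicity \<open>k\<close> is open and closed in the unit
  interval. Uniqueness is asked for only before the end point: in the application that point is the
  barycenter of a ridge, which is interior to no facet.\<close>

lemma has_multiplicity_path:
  assumes p: "pathin X p" and z: "\<And>t. t \<in> {0..1} \<Longrightarrow> singular_relcycle d X (topspace X - {p t}) z"
    and uniq: "\<And>t k l. t \<in> {0..<1} \<Longrightarrow> has_multiplicity z (p t) k \<Longrightarrow> has_multiplicity z (p t) l \<Longrightarrow> k = l"
    and k: "has_multiplicity z (p 1) k"
  shows "has_multiplicity z (p 0) k"
proof -
  let ?I = "top_of_set {0..1::real}"
  define A where "A = {t \<in> {0..1}. has_multiplicity z (p t) k}"
  have cont: "continuous_map ?I X p" using p by (simp add: pathin_def)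
  have inX: "p t \<in> topspace X" if "t \<in> {0..1}" for t
    using cont that by (auto simp: continuous_map_def)
  have nbhd: "\<exists>T. openin ?I T \<and> t \<in> T \<and> (\<forall>s\<in>T. has_multiplicity z (p s) j)"
    if t: "t \<in> {0..1}" and j: "has_multiplicity z (p t) j" for t j
  proof -
    obtain W where W: "openin X W" "p t \<in> W" "\<forall>y\<in>W. has_multiplicity z y j"
      using has_multiplicity_locally_constant[OF j inX[OF t]] by blast
    then show ?thesis
      using openin_continuous_map_preimage[OF cont W(1)] t by (intro exI[of _ "{x \<in> topspace ?I. p x \<in> W}"]) auto
  qed
  have "openin ?I A"
    unfolding openin_subopen[of ?I A]
  proof
    fix t assume "t \<in> A"
    then obtain T where T: "openin ?I T" "t \<in> T" "\<forall>s\<in>T. has_multiplicity z (p s) k"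
      using nbhd[of t k] unfolding A_def by blast
    moreover have "T \<subseteq> A" using T openin_subset[OF T(1)] by (auto simp: A_def)
    ultimately show "\<exists>T. openin ?I T \<and> t \<in> T \<and> T \<subseteq> A" by blast
  qed
  moreover have "openin ?I ({0..1} - A)"
    unfolding openin_subopen[of ?I "{0..1} - A"]
  proof
    fix t assume t: "t \<in> {0..1} - A"
    then have t01: "t \<in> {0..1}" "t \<noteq> 1" using k by (auto simp: A_def)
    obtain j where j: "has_multiplicity z (p t) j"
      using has_multiplicity_exists[OF inX z] t01 by blast
    obtain T where T: "openin ?I T" "t \<in> T" "\<forall>s\<in>T. has_multiplicity z (p s) j"
      using nbhd[OF t01(1) j] by blast
    \<comment> \<open>A time of \<open>A\<close> in \<open>T\<close> would carry both multiplicities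
      \<open>k\<close> and \<open>j\<close>, so \<open>t\<close> itself would belong to
      \<open>A\<close>.\<close>
    have "s \<notin> A" if "s \<in> T" "s < 1" for s
    proof
      assume sA: "s \<in> A"
      then have "k = j" using T that uniq[of s k j] by (auto simp: A_def)
      then show False using t j by (auto simp: A_def)
    qed
    \<comment> \<open>\<open>T\<close> is cut down to the times before 1, where uniqueness is
      available.\<close>
    moreover have "openin ?I ({0..1} \<inter> {..<1})"
      by (simp add: openin_open_Int)
    then have "openin ?I (T \<inter> ({0..1} \<inter> {..<1}))"
      by (rule openin_Int[OF T(1)])
    ultimately show "\<exists>T. openin ?I T \<and> t \<in> T \<and> T \<subseteq> {0..1} - A"
      using T t01 by (intro exI[of _ "T \<inter> ({0..1} \<inter> {..<1})"]) auto
  qed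
  then have "closedin ?I A"
    by (auto simp: closedin_def A_def)
  ultimately have "A = {} \<or> A = {0..1}"
    using connected_clopen[of "{0..1::real}"] by simp
  moreover have "1 \<in> A" using k by (simp add: A_def)
  ultimately have "0 \<in> A" by auto
  then show ?thesis by (simp add: A_def)
qed

end

section \<open>Coherent orientations of triangulated manifolds\<close>

text \<open>The entries of the sorted list are distinct, so exactly one summand of
  \<open>incidence\<close> survives, that of the vertex missing in \<open>r\<close>.\<close>

lemma codim1_face_obtain_index:
  fixes f :: "'a::linorder set"
  assumes "codim1_face r f" "finite f"
  obtains j where "j < card f" "r = f - {sorted_list_of_set f ! j}" "incidence r f = (-1) ^ j"
proof -
  let ?s = "sorted_list_of_set f"
  have r: "r \<subseteq> f" "card f = card r + 1" "finite r" using assms by (auto simp: codim1_face_def finite_subset)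
  then have "card (f - r) = 1" using assms(2) by (simp add: card_Diff_subset)
  then obtain v where v: "f - r = {v}" by (meson card_1_singletonE)
  then have rv: "r = f - {v}" using r by auto
  have "v \<in> set ?s" using v assms(2) by auto
  then obtain j where j: "j < card f" "?s ! j = v" 
    using assms(2) by (metis in_set_conv_nth length_sorted_list_of_set)
  have "(if r = f - {?s ! i} then (-1) ^ i else 0) = (if i = j then (-1) ^ i else (0::real))" if "i < card f" for i
  proof -
    have "?s ! i \<in> f" "?s ! j \<in> f" using that j assms(2) nth_mem[of i ?s] nth_mem[of j ?s] by auto
    then have "r = f - {?s ! i} \<longleftrightarrow> ?s ! i = ?s ! j" unfolding rv j(2) by blast
    also have "\<dots> \<longleftrightarrow> i = j" using that j(1) assms(2) by (simp add: nth_eq_iff_index_eq)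
    finally show ?thesis by simp
  qed
  then have "incidence r f = (\<Sum>i<card f. if i = j then (-1) ^ i else 0)"
    unfolding incidence_def by (intro sum.cong) auto
  also have "\<dots> = (-1) ^ j" using j(1) by simp
  finally show ?thesis using that[of j] j rv by auto
qed

text \<open>The weights \<open>\<kappa>\<close> are nonzero integers rather than signs. This avoids having to prove that the
  simplex of a facet generates the local homology.\<close>

definition coherently_oriented :: "'a::linorder set set \<Rightarrow> int \<Rightarrow> ('a set \<Rightarrow> int) \<Rightarrow> bool" where
  "coherently_oriented K d \<kappa> \<longleftrightarrow>
     (\<forall>f\<in>cells K d. \<kappa> f \<noteq> 0) \<and>
     (\<forall>r\<in>cells K (d - 1). \<forall>f\<in>cells K d. \<forall>g\<in>cells K d. r \<subseteq> f \<longrightarrow> r \<subseteq> g \<longrightarrow> f \<noteq> g \<longrightarrow>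
        real_of_int (\<kappa> f) * incidence r f + real_of_int (\<kappa> g) * incidence r g = 0 \<and>
        (\<forall>h\<in>cells K d. r \<subseteq> h \<longrightarrow> h = f \<or> h = g))"

lemma coherently_oriented_cofaces:
  assumes "coherently_oriented K d \<kappa>" "r \<in> cells K (d - 1)" "f \<in> cells K d" "g \<in> cells K d"
    "r \<subseteq> f" "r \<subseteq> g" "f \<noteq> g"
  shows "real_of_int (\<kappa> f) * incidence r f + real_of_int (\<kappa> g) * incidence r g = 0"
    and "h \<in> cells K d \<Longrightarrow> r \<subseteq> h \<Longrightarrow> h = f \<or> h = g"
  using assms unfolding coherently_oriented_def by blast+

section \<open>Barycenters, and the relative cycle around a ridge\<close>

definition barycenter :: "'a set \<Rightarrow> 'a \<Rightarrow> real" where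
  "barycenter \<sigma> = (\<lambda>v. if v \<in> \<sigma> then 1 / real (card \<sigma>) else 0)"

text \<open>For a facet \<open>f\<close> and one of its ridges \<open>r\<close>, this segment is the
  path along which multiplicities are compared.\<close>

lemma barycenter_segment_in_realization:
  assumes f: "finite f" "Pow f \<subseteq> K" and r: "r \<subseteq> f" "r \<noteq> {}" and t: "t \<in> {0..1}"
  shows "(\<lambda>v. (1 - t) * barycenter f v + t * barycenter r v) \<in> realization_carrier K"
proof -
  let ?x = "\<lambda>v. (1 - t) * barycenter f v + t * barycenter r v"
  have fr: "finite r" "f \<noteq> {}" using f r by (auto simp: finite_subset)
  have supp: "{v. ?x v \<noteq> 0} \<subseteq> f" using r by (auto simp: barycenter_def)
  have b: "(\<Sum>v\<in>f. barycenter s v) = 1" if "s \<subseteq> f" "s \<noteq> {}" for s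
  proof -
    have "(\<Sum>v\<in>f. barycenter s v) = (\<Sum>v\<in>s. 1 / real (card s))"
      using that f(1) by (intro sum.mono_neutral_cong_right) (auto simp: barycenter_def)
    then show ?thesis using that f(1) by (simp add: finite_subset)
  qed
  have "(\<Sum>v\<in>{v. ?x v \<noteq> 0}. ?x v) = (\<Sum>v\<in>f. ?x v)"
    using supp f by (intro sum.mono_neutral_left) auto
  also have "\<dots> = (1 - t) * (\<Sum>v\<in>f. barycenter f v) + t * (\<Sum>v\<in>f. barycenter r v)"
    by (simp add: sum.distrib sum_distrib_left)
  also have "\<dots> = 1" using b[of f] b[OF r] fr by simp
  finally show ?thesis
  proof -
    have "0 \<le> barycenter f v" "0 \<le> barycenter r v" for v by (auto simp: barycenter_def)
    then have "\<forall>v. 0 \<le> ?x v" using t by (auto intro!: add_nonneg_nonneg)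
    moreover have "{v. ?x v \<noteq> 0} \<in> K" using supp f(2) by blast
    moreover assume "(\<Sum>v\<in>{v. ?x v \<noteq> 0}. ?x v) = 1"
    ultimately show ?thesis unfolding realization_carrier_def by blast
  qed
qed

lemma barycenter_in_realization:
  assumes "finite f" "Pow f \<subseteq> K" "f \<noteq> {}"
  shows "barycenter f \<in> realization_carrier K"
  using barycenter_segment_in_realization[of f K f 0] assms by simp

lemma barycenter_pos: "finite f \<Longrightarrow> v \<in> f \<Longrightarrow> 0 < barycenter f v"
  by (auto simp: barycenter_def card_gt_0_iff)

lemma cell_simplex_relcycle:
  assumes f: "finite f" "card f = Suc p" "Pow f \<subseteq> K" and y: "\<And>v. v \<in> f \<Longrightarrow> 0 < y v"
  shows "singular_relcycle p (geometric_realization K) (realization_carrier K - {y}) (frag_of (cell_simplex f))"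
proof -
  have "singular_chain (p - 1) (subtopology (geometric_realization K) (realization_carrier K - {y}))
          (chain_boundary p (frag_of (cell_simplex f)))"
    using y by (intro singular_chain_boundary_cell_simplex[OF f]) force
  then show ?thesis
    using singular_simplex_cell_simplex[OF f] by (simp add: singular_relcycle singular_chain_of)
qed

text \<open>With its sign, each of the two simplices has \<open>r\<close> with coefficient 1 in its
  boundary, so \<open>r\<close> cancels in the difference. Every other face omits a vertex of
  \<open>r\<close> and thus misses the open star of \<open>r\<close>.\<close>

lemma boundary_star_relcycle:
  fixes f g :: "'a::linorder set"
  assumes p: "1 \<le> p"
    and f: "finite f" "card f = Suc p" "Pow f \<subseteq> K" and g: "finite g" "card g = Suc p" "Pow g \<subseteq> K"
    and i: "i \<le> p" "r = f - {sorted_list_of_set f ! i}" and j: "j \<le> p" "r = g - {sorted_list_of_set g ! j}"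
  shows "singular_relcycle p (geometric_realization K) (realization_carrier K - {x. \<forall>v\<in>r. 0 < x v})
    (frag_cmul ((-1) ^ i) (frag_of (cell_simplex f)) - frag_cmul ((-1) ^ j) (frag_of (cell_simplex g)))"
proof -
  let ?X = "geometric_realization K" and ?S = "realization_carrier K - {x. \<forall>v\<in>r. 0 < x v}"
  have *: "singular_chain (p - 1) (subtopology ?X ?S) (chain_boundary p (frag_cmul ((-1) ^ k) (frag_of (cell_simplex h))) - frag_of (cell_simplex r))"
    if h: "finite h" "card h = Suc p" "Pow h \<subseteq> K" and k: "k \<le> p" "r = h - {sorted_list_of_set h ! k}" for h k
  proof -
    let ?F = "\<lambda>l. h - {sorted_list_of_set h ! l}"
    have mem: "sorted_list_of_set h ! l \<in> h" if "l \<le> p" for l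
      using that h nth_mem[of l "sorted_list_of_set h"] by auto
    have "chain_boundary p (frag_cmul ((-1) ^ k) (frag_of (cell_simplex h)))
        = (\<Sum>l\<le>p. frag_cmul ((-1) ^ k * (-1) ^ l) (frag_of (cell_simplex (?F l))))"
      using h p by (simp add: chain_boundary_cmul chain_boundary_cell_simplex frag_cmul_sum)
    also have "\<dots> = frag_cmul ((-1) ^ k * (-1) ^ k) (frag_of (cell_simplex (?F k)))
        + (\<Sum>l\<in>{..p} - {k}. frag_cmul ((-1) ^ k * (-1) ^ l) (frag_of (cell_simplex (?F l))))"
      using k(1) by (intro sum.remove) auto
    finally have eq: "chain_boundary p (frag_cmul ((-1) ^ k) (frag_of (cell_simplex h))) - frag_of (cell_simplex r)
        = (\<Sum>l\<in>{..p} - {k}. frag_cmul ((-1) ^ k * (-1) ^ l) (frag_of (cell_simplex (?F l))))"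
      using k(2) by (simp flip: power_mult_distrib)
    have "singular_chain (p - 1) (subtopology ?X ?S) (frag_of (cell_simplex (?F l)))" if l: "l \<in> {..p} - {k}" for l
    proof (rule singular_chain_cell_simplex_within)
      show "card (?F l) = Suc (p - 1)" using h mem[of l] l p by simp
      have "sorted_list_of_set h ! l \<noteq> sorted_list_of_set h ! k"
        using l k(1) h by (simp add: nth_eq_iff_index_eq)
      then have "sorted_list_of_set h ! l \<in> r" using k(2) mem[of l] l by auto
      then show "x \<in> ?S" if "x \<in> realization_carrier K" "\<And>v. v \<notin> ?F l \<Longrightarrow> x v = 0" for x
        using that by force
    qed (use h in auto)
    then show ?thesis
      unfolding eq by (intro singular_chain_sum singular_chain_cmul)
  qed
  have "singular_chain (p - 1) (subtopology ?X ?S) 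
     (chain_boundary p (frag_cmul ((-1) ^ i) (frag_of (cell_simplex f)) - frag_cmul ((-1) ^ j) (frag_of (cell_simplex g))))"
    using singular_chain_diff[OF *[OF f i] *[OF g j]] by (simp add: chain_boundary_diff)
  moreover have "singular_chain p ?X (frag_cmul ((-1) ^ i) (frag_of (cell_simplex f)) - frag_cmul ((-1) ^ j) (frag_of (cell_simplex g)))"
    using singular_simplex_cell_simplex[OF f] singular_simplex_cell_simplex[OF g]
    by (intro singular_chain_diff singular_chain_cmul) (auto simp: singular_chain_of)
  ultimately show ?thesis by (simp add: singular_relcycle)
qed

text \<open>Let \<open>z\<close> be the signed difference of the simplices of \<open>f\<close> and
  \<open>g\<close>, pushed to \<open>M\<close>. Its multiplicity is
  \<open>(-1) ^ i * \<kappa> f\<close> at the barycenter of \<open>f\<close>,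
  \<open>- ((-1) ^ j) * \<kappa> g\<close> at that of \<open>g\<close>, and 0 at that of any other
  coface of \<open>r\<close>. All of these equal one multiplicity \<open>k\<close> at the barycenter
  of \<open>r\<close>.\<close>

lemma coherent_orientation_exists:
  fixes K :: "'a::linorder set set" and M :: "'b topology"
  assumes K: "abstract_simplicial_complex K" and dim: "has_dimension K (int d)" and d: "1 \<le> d"
    and M: "Hausdorff_space M" "orientation d M \<mu>"
    and hom: "homeomorphic_maps (geometric_realization K) M \<phi> \<psi>"
  shows "\<exists>\<kappa>. coherently_oriented K (int d) \<kappa>"
proof -
  interpret oriented_space d M \<mu> using M by unfold_locales
  let ?X = "geometric_realization K" and ?R = "realization_carrier K"
  have c\<phi>: "continuous_map ?X M \<phi>" and c\<psi>: "continuous_map M ?X \<psi>" 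
    and \<psi>\<phi>: "\<And>x. x \<in> ?R \<Longrightarrow> \<psi> (\<phi> x) = x" and \<phi>\<psi>: "\<And>x. x \<in> topspace M \<Longrightarrow> \<phi> (\<psi> x) = x"
    using hom by (auto simp: homeomorphic_maps_def)
  have \<phi>M: "\<phi> x \<in> topspace M" if "x \<in> ?R" for x
    using c\<phi> that by (auto simp: continuous_map_def)
  have \<psi>R: "\<psi> x \<in> ?R" if "x \<in> topspace M" for x
    using c\<psi> that by (auto simp: continuous_map_def)
  have cell: "finite f" "Pow f \<subseteq> K" if "f \<in> K" for f
    using K that by (auto simp: abstract_simplicial_complex_def)
  define D where "D = cells K (int d)"
  have Df: "finite f" "card f = Suc d" "Pow f \<subseteq> K" "f \<in> K" "f \<noteq> {}" if "f \<in> D" for f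
    using that cell[of f] by (auto simp: D_def cells_def)
  have max: "\<tau> = f" if f: "f \<in> D" and \<tau>: "\<tau> \<in> K" "f \<subseteq> \<tau>" for f \<tau>
  proof -
    have "int (card \<tau>) \<le> int d + 1" using dim \<tau>(1) unfolding has_dimension_def by blast
    then have "card \<tau> \<le> card f" using Df(2)[OF f] by simp
    then show ?thesis using card_seteq[OF cell(1)[OF \<tau>(1)] \<tau>(2)] by simp
  qed
  define e where "e f = frag_of (cell_simplex f)" for f :: "'a set"
  define s where "s f = chain_map d \<phi> (e f)" for f
  have ech: "singular_chain d ?X (e f)" if "f \<in> D" for f
    using singular_simplex_cell_simplex[of f d K] Df[OF that] by (simp add: e_def singular_chain_of)
  have push: "\<phi> \<in> ?R - S \<rightarrow> topspace M - {\<phi> y}" if "y \<in> ?R" "y \<in> S" for S y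
  proof
    fix x assume x: "x \<in> ?R - S"
    then have "x \<noteq> y" using that(2) by blast
    then have "\<phi> x \<noteq> \<phi> y" using \<psi>\<phi> x that(1) by (metis DiffD1)
    then show "\<phi> x \<in> topspace M - {\<phi> y}" using \<phi>M x by blast
  qed
  have s_cycle: "singular_relcycle d M (topspace M - {\<phi> y}) (s f)"
    if "f \<in> D" "y \<in> ?R" "\<And>v. v \<in> f \<Longrightarrow> 0 < y v" for f y
    unfolding s_def e_def
    by (rule singular_relcycle_chain_map[OF cell_simplex_relcycle c\<phi>]) (use push[of y "{y}"] that Df in auto)
  \<comment> \<open>The inverse map \<open>\<psi>\<close> brings the relation back to the
    realization, where the simplex has infinite order because facets are maximal.\<close>
  have s_inf: "k = 0" if f: "f \<in> D" and y: "y \<in> ?R" "\<And>v. v \<in> f \<Longrightarrow> 0 < y v"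
    and b: "singular_relboundary d M (topspace M - {\<phi> y}) (frag_cmul k (s f))" for f y k
  proof -
    have "chain_map d \<psi> (s f) = chain_map d (\<psi> \<circ> \<phi>) (e f)"
      by (simp add: s_def chain_map_compose)
    also have "\<dots> = e f"
      using \<psi>\<phi> by (intro chain_map_id_gen[OF ech[OF f]]) auto
    finally have eq: "chain_map d \<psi> (frag_cmul k (s f)) = frag_cmul k (e f)" by simp
    have "\<psi> \<in> topspace M - {\<phi> y} \<rightarrow> ?R - {y}" using \<psi>R \<phi>\<psi> by auto
    then have "singular_relboundary d ?X (?R - {y}) (frag_cmul k (e f))"
      using singular_relboundary_chain_map[OF b c\<psi>] eq by metis
    then show ?thesis
      unfolding e_def
      by (rule cell_simplex_infinite_order[of f d K y k, rotated 6]) (use Df[OF f] max[OF f] y in auto)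
  qed
  have uniq: "k = l" if f: "f \<in> D" and y: "y \<in> ?R" "\<And>v. v \<in> f \<Longrightarrow> 0 < y v"
    and kl: "has_multiplicity z (\<phi> y) k" "has_multiplicity z (\<phi> y) l" for f y z k l
    by (rule has_multiplicity_unique[OF kl \<phi>M[OF y(1)] s_cycle[OF f y] s_inf[OF f y]])
  \<comment> \<open>A vertex \<open>v\<close> outside \<open>f\<close> with \<open>y v\<close>
    nonzero keeps \<open>y\<close> off the closed cell \<open>f\<close>.\<close>
  have avoid: "has_multiplicity (s f) (\<phi> y) 0" if f: "f \<in> D" and y: "y \<in> ?R" "v \<notin> f" "y v \<noteq> 0" for f y v
  proof (rule has_multiplicity_0[OF \<phi>M[OF y(1)]])
    have "singular_chain d (subtopology ?X (?R - {y})) (e f)"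
      unfolding e_def using Df[OF f] y by (intro singular_chain_cell_simplex_within) auto
    moreover have "continuous_map (subtopology ?X (?R - {y})) (subtopology M (topspace M - {\<phi> y})) \<phi>"
      using c\<phi> push[of y "{y}"] y(1) by (auto simp: continuous_map_in_subtopology continuous_map_from_subtopology)
    ultimately have "singular_chain d (subtopology M (topspace M - {\<phi> y})) (s f)"
      unfolding s_def by (rule singular_chain_chain_map)
    then show "singular_relboundary d M (topspace M - {\<phi> y}) (s f)"
      by (rule singular_chain_imp_relboundary)
  qed
  define \<beta> where "\<beta> = (barycenter :: 'a set \<Rightarrow> 'a \<Rightarrow> real)"
  have \<beta>R: "\<beta> f \<in> ?R" if "f \<in> D" for f
    using barycenter_in_realization Df[OF that] by (simp add: \<beta>_def)
  have \<beta>pos: "0 < \<beta> f v" if "f \<in> D" "v \<in> f" for f v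
    using barycenter_pos Df[OF that(1)] that(2) by (simp add: \<beta>_def)
  define \<kappa> where "\<kappa> f = (SOME k. has_multiplicity (s f) (\<phi> (\<beta> f)) k)" for f
  have \<kappa>: "has_multiplicity (s f) (\<phi> (\<beta> f)) (\<kappa> f)" if f: "f \<in> D" for f
    unfolding \<kappa>_def
    by (rule someI_ex, rule has_multiplicity_exists[OF \<phi>M[OF \<beta>R[OF f]] s_cycle[OF f \<beta>R[OF f] \<beta>pos[OF f]]])
  have \<kappa>0: "\<kappa> f \<noteq> 0" if f: "f \<in> D" for f
  proof
    \<comment> \<open>Multiplicity 0 would make \<open>s f\<close> itself a relative
      boundary.\<close>
    assume "\<kappa> f = 0"
    then have "singular_relboundary d M (topspace M - {\<phi> (\<beta> f)}) (frag_cmul 1 (s f))"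
      using \<kappa>[OF f] unfolding has_multiplicity_def homologous_rel_def by auto
    then have "(1::int) = 0" using s_inf[OF f \<beta>R[OF f], of 1] \<beta>pos[OF f] by blast
    then show False by simp
  qed
  have distinct_cells: "\<exists>v\<in>h. v \<notin> f" if "f \<in> D" "h \<in> D" "f \<noteq> h" for f h
    using that max[of h f] Df(4)[of f] by blast
  have key: "real_of_int (\<kappa> f) * incidence r f + real_of_int (\<kappa> g) * incidence r g = 0 \<and>
        (\<forall>h\<in>D. r \<subseteq> h \<longrightarrow> h = f \<or> h = g)"
    if r: "r \<in> cells K (int d - 1)" and f: "f \<in> D" and g: "g \<in> D" and rf: "r \<subseteq> f" and rg: "r \<subseteq> g" and fg: "f \<noteq> g" for r f g
  proof -
    have rK: "r \<in> K" "card r = d" using r by (auto simp: cells_def)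
    then have rne: "r \<noteq> {}" "finite r" using d cell(1)[of r] by auto
    have "codim1_face r f" "codim1_face r g"
      using rK rf rg Df f g by (auto simp: codim1_face_def)
    then obtain i j where i: "i < card f" "r = f - {sorted_list_of_set f ! i}" "incidence r f = (-1) ^ i"
      and j: "j < card g" "r = g - {sorted_list_of_set g ! j}" "incidence r g = (-1) ^ j"
      using codim1_face_obtain_index Df f g by metis
    define z where "z = chain_map d \<phi> (frag_cmul ((-1) ^ i) (e f) - frag_cmul ((-1) ^ j) (e g))"
    have z: "z = frag_cmul ((-1) ^ i) (s f) + frag_cmul (- ((-1) ^ j)) (s g)"
      by (simp add: z_def s_def chain_map_diff flip: minus_frag_cmul)
    have zcyc: "singular_relcycle d M (topspace M - {\<phi> y}) z" if y: "y \<in> ?R" "\<And>v. v \<in> r \<Longrightarrow> 0 < y v" for y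
      unfolding z_def e_def
      by (rule singular_relcycle_chain_map[OF boundary_star_relcycle c\<phi>])
         (use push[of y "{x. \<forall>v\<in>r. 0 < x v}"] y d Df f g i j in auto)
    have \<beta>r: "\<beta> r \<in> ?R" "\<And>v. v \<in> r \<Longrightarrow> 0 < \<beta> r v"
      using barycenter_in_realization[of r K] barycenter_pos[of r] cell[OF rK(1)] rne by (auto simp: \<beta>_def)
    \<comment> \<open>Some multiplicity at the ridge is fixed; uniqueness is known only at interior
      points of facets.\<close>
    obtain k where k: "has_multiplicity z (\<phi> (\<beta> r)) k"
      using has_multiplicity_exists[OF \<phi>M zcyc] \<beta>r by blast
    have transport: "has_multiplicity z (\<phi> (\<beta> h)) k" if h: "h \<in> D" "r \<subseteq> h" for h
    proof -
      \<comment> \<open>Along the segment the coordinates of \<open>r\<close> stay positive, so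
        \<open>z\<close> remains a relative cycle. Before the end all coordinates of
        \<open>h\<close> are positive, which gives uniqueness.\<close>
      define q where "q t = (\<lambda>v. (1 - t) * \<beta> h v + t * \<beta> r v)" for t :: real
      have qR: "q t \<in> ?R" if "t \<in> {0..1}" for t
        unfolding q_def \<beta>_def using barycenter_segment_in_realization[of h K r t] Df[OF h(1)] h(2) rne that by simp
      have nn: "0 \<le> \<beta> r v" for v by (simp add: \<beta>_def barycenter_def)
      have qpos: "0 < q t v" if "t \<in> {0..<1}" "v \<in> h" for t v
        using that \<beta>pos[OF h(1) that(2)] nn[of v] by (auto simp: q_def intro!: add_pos_nonneg)
      have q1: "q 1 = \<beta> r" and q0: "q 0 = \<beta> h" by (auto simp: q_def)
      have qr: "0 < q t v" if "t \<in> {0..1}" "v \<in> r" for t v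
      proof (cases "t = 1")
        case True then show ?thesis using q1 \<beta>r that by simp
      next
        case False then show ?thesis using qpos that h(2) by auto
      qed
      have "continuous_map (top_of_set {0..1}) ?X q"
        unfolding geometric_realization_eq continuous_map_in_subtopology
      proof (intro conjI)
        show "continuous_map (top_of_set {0..1}) (powertop_real UNIV) q"
          unfolding continuous_map_componentwise_UNIV q_def by (auto intro!: continuous_intros)
      qed (use qR in auto)
      then have "pathin M (\<phi> \<circ> q)"
        unfolding pathin_def using c\<phi> by (rule continuous_map_compose)
      then have "has_multiplicity z ((\<phi> \<circ> q) 0) k"
      proof (rule has_multiplicity_path)
        show "singular_relcycle d M (topspace M - {(\<phi> \<circ> q) t}) z" if "t \<in> {0..1}" for t
          using zcyc[OF qR qr] that by simp
        show "k = l" if "t \<in> {0..<1}" "has_multiplicity z ((\<phi> \<circ> q) t) k" "has_multiplicity z ((\<phi> \<circ> q) t) l" for t k l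
          using uniq[OF h(1), of "q t" z k l] qR qpos that by auto
        show "has_multiplicity z ((\<phi> \<circ> q) 1) k" using k q1 by simp
      qed
      then show ?thesis by (simp add: q0)
    qed
    have off: "has_multiplicity (s f) (\<phi> (\<beta> h)) 0" if "f \<in> D" "h \<in> D" "f \<noteq> h" for f h
    proof -
      obtain v where "v \<in> h" "v \<notin> f" using distinct_cells \<open>f \<in> D\<close> \<open>h \<in> D\<close> \<open>f \<noteq> h\<close> by blast
      then show ?thesis using avoid[OF \<open>f \<in> D\<close> \<beta>R[OF \<open>h \<in> D\<close>], of v] \<beta>pos[OF \<open>h \<in> D\<close>, of v] by simp
    qed
    have u: "l = k" if h: "h \<in> D" "r \<subseteq> h" and l: "has_multiplicity z (\<phi> (\<beta> h)) l" for h l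
      using uniq[OF h(1) \<beta>R[OF h(1)] \<beta>pos[OF h(1)] l transport[OF h]] by simp
    have kf: "(-1) ^ i * \<kappa> f = k"
      using u[OF f rf] has_multiplicity_lincomb[OF \<kappa>[OF f] off[OF g f], of "(-1) ^ i" "- ((-1) ^ j)"] fg
      by (simp add: z)
    have kg: "- ((-1) ^ j) * \<kappa> g = k"
      using u[OF g rg] has_multiplicity_lincomb[OF off[OF f g] \<kappa>[OF g], of "(-1) ^ i" "- ((-1) ^ j)"] fg
      by (simp add: z)
    \<comment> \<open>At a third coface both simplices contribute 0, which would force
      \<open>k = 0\<close> against \<open>kf\<close>.\<close>
    have "h = f \<or> h = g" if h: "h \<in> D" "r \<subseteq> h" for h
    proof (rule ccontr)
      assume "\<not> ?thesis"
      then have "f \<noteq> h" "g \<noteq> h" by auto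
      then have "k = 0"
        using u[OF h, of 0] has_multiplicity_lincomb[OF off[OF f h(1)] off[OF g h(1)], of "(-1) ^ i" "- ((-1) ^ j)"]
        by (simp add: z)
      then show False using kf \<kappa>0[OF f] by simp
    qed
    moreover have "\<kappa> f * (-1) ^ i + \<kappa> g * (-1) ^ j = 0" using kf kg by (simp add: mult.commute)
    then have "real_of_int (\<kappa> f * (-1) ^ i + \<kappa> g * (-1) ^ j) = 0" by (simp only: of_int_0)
    then have "real_of_int (\<kappa> f) * incidence r f + real_of_int (\<kappa> g) * incidence r g = 0"
      by (simp add: i(3) j(3))
    ultimately show ?thesis by blast
  qed
  show ?thesis
    unfolding coherently_oriented_def using \<kappa>0 key unfolding D_def by blast
qed

section \<open>Determinants\<close>

lemma det_mat_leibniz: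
  "Determinant.det (mat n n (\<lambda>(i, j). A i j)) =
     (\<Sum>p | p permutes {0..<n}. signof p * (\<Prod>i = 0..<n. A i (p i)))"
proof -
  have "(\<Prod>i = 0..<n. mat n n (\<lambda>(i, j). A i j) $$ (i, p i)) = (\<Prod>i = 0..<n. A i (p i))"
    if "p permutes {0..<n}" for p
    using that permutes_in_image[OF that] by (intro prod.cong) auto
  then show ?thesis
    by (subst det_def'[of _ n]) (auto intro!: sum.cong)
qed

text \<open>In each Leibniz term a product of sums is a sum over the choices of one summand per
  row.\<close>

lemma det_sum_rows:
  fixes T :: "nat \<Rightarrow> nat \<Rightarrow> 'o \<Rightarrow> 'c::comm_ring_1"
  assumes "finite S"
  shows "Determinant.det (mat n n (\<lambda>(i, j). \<Sum>s\<in>S. T i j s)) =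
    (\<Sum>\<phi>\<in>{0..<n} \<rightarrow>\<^sub>E S. Determinant.det (mat n n (\<lambda>(i, j). T i j (\<phi> i))))"
proof -
  have "Determinant.det (mat n n (\<lambda>(i, j). \<Sum>s\<in>S. T i j s)) =
      (\<Sum>p | p permutes {0..<n}. \<Sum>\<phi>\<in>{0..<n} \<rightarrow>\<^sub>E S. signof p * (\<Prod>i = 0..<n. T i (p i) (\<phi> i)))"
    using assms by (simp add: det_mat_leibniz prod_sum_PiE sum_distrib_left)
  also have "\<dots> = (\<Sum>\<phi>\<in>{0..<n} \<rightarrow>\<^sub>E S. \<Sum>p | p permutes {0..<n}. signof p * (\<Prod>i = 0..<n. T i (p i) (\<phi> i)))"
    by (rule sum.swap)
  finally show ?thesis by (simp add: det_mat_leibniz)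
qed

lemma det_eq_0_right_kernel:
  fixes A :: "nat \<Rightarrow> nat \<Rightarrow> real"
  assumes "j < n" "y j \<noteq> 0" "\<And>i. i < n \<Longrightarrow> (\<Sum>j<n. A i j * y j) = 0"
  shows "Determinant.det (mat n n (\<lambda>(i, j). A i j)) = 0"
proof -
  let ?A = "mat n n (\<lambda>(i, j). A i j)" and ?v = "Matrix.vec n y"
  have "?v \<noteq> 0\<^sub>v n"
    using assms(1,2) by (metis index_vec index_zero_vec(1))
  moreover have "?A *\<^sub>v ?v = 0\<^sub>v n"
    using assms(3) by (intro eq_vecI) (auto simp: scalar_prod_def lessThan_atLeast0)
  ultimately show ?thesis
    using det_0_iff_vec_prod_zero[of ?A n] by (auto intro!: exI[of _ ?v])
qed

lemma det_eq_0_left_kernel: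
  fixes A :: "nat \<Rightarrow> nat \<Rightarrow> real"
  assumes "i < n" "y i \<noteq> 0" "\<And>j. j < n \<Longrightarrow> (\<Sum>i<n. A i j * y i) = 0"
  shows "Determinant.det (mat n n (\<lambda>(i, j). A i j)) = 0"
proof -
  have "transpose_mat (mat n n (\<lambda>(i, j). A i j)) = mat n n (\<lambda>(i, j). A j i)"
    by (auto intro!: eq_matI)
  then have "Determinant.det (mat n n (\<lambda>(i, j). A i j)) = Determinant.det (mat n n (\<lambda>(i, j). A j i))"
    using det_transpose[of "mat n n (\<lambda>(i, j). A i j)" n] by simp
  also have "\<dots> = 0"
    by (rule det_eq_0_right_kernel[of i n y]) (use assms in auto)
  finally show ?thesis .
qed

text \<open>If \<open>w\<close> strictly decreases along every off-diagonal nonzero entry, then no permutation other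
  than the identity contributes to the determinant, because it preserves the sum of \<open>w\<close>.\<close>

lemma det_eq_prod_diag:
  fixes A :: "nat \<Rightarrow> nat \<Rightarrow> real" and w :: "nat \<Rightarrow> real"
  assumes "\<And>i j. i < n \<Longrightarrow> j < n \<Longrightarrow> i \<noteq> j \<Longrightarrow> A i j \<noteq> 0 \<Longrightarrow> w j < w i"
  shows "Determinant.det (mat n n (\<lambda>(i, j). A i j)) = (\<Prod>i<n. A i i)"
proof -
  have *: "(\<Prod>i = 0..<n. A i (p i)) = 0" if p: "p permutes {0..<n}" "p \<noteq> id" for p
  proof (rule ccontr)
    assume "(\<Prod>i = 0..<n. A i (p i)) \<noteq> 0"
    then have nz: "A i (p i) \<noteq> 0" if "i < n" for i using that by auto
    have pn: "p i < n" if "i < n" for i using permutes_in_image[OF p(1), of i] that by simp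
    have le: "w (p i) \<le> w i" if "i < n" for i
      using assms[OF that pn[OF that] _ nz[OF that]] by (cases "i = p i") auto
    obtain i where i: "p i \<noteq> i" using p(2) by (auto simp: fun_eq_iff)
    then have "i < n" using p(1) by (meson atLeastLessThan_iff permutes_not_in zero_le)
    then have "w (p i) < w i" using assms[OF \<open>i < n\<close> pn[OF \<open>i < n\<close>] _ nz[OF \<open>i < n\<close>]] i by auto
    then have "(\<Sum>i\<in>{0..<n}. w (p i)) < (\<Sum>i\<in>{0..<n}. w i)"
      using le \<open>i < n\<close> by (intro sum_strict_mono_ex1) auto
    moreover have "(\<Sum>i\<in>{0..<n}. w (p i)) = (\<Sum>i\<in>{0..<n}. w i)"
      using sum.permute[OF p(1), of w] by (simp add: o_def)
    ultimately show False by simp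
  qed
  have "Determinant.det (mat n n (\<lambda>(i, j). A i j)) =
      (\<Sum>p | p permutes {0..<n}. signof p * (\<Prod>i = 0..<n. A i (p i)))"
    by (rule det_mat_leibniz)
  also have "\<dots> = (\<Sum>p\<in>{id}. signof p * (\<Prod>i = 0..<n. A i (p i)))"
    using * by (intro sum.mono_neutral_right) (auto simp: finite_permutations permutes_id)
  finally show ?thesis by (simp add: lessThan_atLeast0)
qed

section \<open>Gradients pairing ridges with facets\<close>

lemma lower_exceptions_gradient:
  "\<sigma> \<in> K \<Longrightarrow> lower_exceptions K f \<sigma> = {\<tau>. (\<tau>, \<sigma>) \<in> gradient K f}"
  by (auto simp: lower_exceptions_def gradient_def)

lemma upper_exceptions_gradient:
  "\<sigma> \<in> K \<Longrightarrow> upper_exceptions K f \<sigma> = {\<tau>. (\<sigma>, \<tau>) \<in> gradient K f}"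
  by (auto simp: upper_exceptions_def gradient_def)

text \<open>Criticality is thus constant on a Morse class, and conditions on critical cells become
  conditions on the gradient.\<close>

lemma critical_cells_gradient:
  "critical_cells K f p = cells K p - (Domain (gradient K f) \<union> Range (gradient K f))"
  by (auto simp: critical_cells_def lower_exceptions_gradient upper_exceptions_gradient cells_def)

locale simplicial_complex_dim =
  fixes K :: "'a::linorder set set" and d :: nat
  assumes complex: "abstract_simplicial_complex K" and dim: "has_dimension K (int d)"
begin

abbreviation ridges :: "'a set set" where "ridges \<equiv> cells K (int d - 1)"
abbreviation facets :: "'a set set" where "facets \<equiv> cells K (int d)"

lemma finite_complex [simp]: "finite K"
  using complex by (simp add: abstract_simplicial_complex_def)

lemma finite_cells [simp]: "finite (cells K p)"
  by (simp add: cells_def)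

lemma finite_cell: "\<sigma> \<in> K \<Longrightarrow> finite \<sigma>"
  using complex by (simp add: abstract_simplicial_complex_def)

lemma card_cell_le: "\<sigma> \<in> K \<Longrightarrow> card \<sigma> \<le> Suc d"
proof -
  assume "\<sigma> \<in> K"
  then have "int (card \<sigma>) \<le> int d + 1" using dim unfolding has_dimension_def by blast
  then show ?thesis by simp
qed

lemma ridges_iff: "\<sigma> \<in> ridges \<longleftrightarrow> \<sigma> \<in> K \<and> card \<sigma> = d"
  by (auto simp: cells_def)

lemma facets_iff: "\<sigma> \<in> facets \<longleftrightarrow> \<sigma> \<in> K \<and> card \<sigma> = Suc d"
  by (auto simp: cells_def)

section \<open>Gradients as matchings between ridges and facets, and the classes they count\<close>

definition ridge_pairs :: "('a set \<times> 'a set) set" where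
  "ridge_pairs = {(r, f). r \<in> ridges \<and> f \<in> facets \<and> codim1_face r f}"

definition top_gradients :: "('a set \<times> 'a set) set set" where
  "top_gradients = {gradient K f | f. f \<in> discrete_morse_functions K \<and> gradient K f \<subseteq> ridge_pairs}"

lemma finite_ridge_pairs: "finite ridge_pairs"
  by (rule finite_subset[of _ "ridges \<times> facets"]) (auto simp: ridge_pairs_def)

lemma finite_top_gradients: "finite top_gradients"
  by (rule finite_subset[of _ "Pow ridge_pairs"]) (auto simp: top_gradients_def finite_ridge_pairs)

text \<open>Criticality of all cells of dimension below \<open>d - 1\<close> means that no pair
  touches them. The upper cell of a pair has dimension at most \<open>d\<close>, so the lower one
  then has dimension exactly \<open>d - 1\<close>.\<close>

lemma gradient_subset_ridge_pairs_iff: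
  "gradient K f \<subseteq> ridge_pairs \<longleftrightarrow> (\<forall>p<int d - 1. card (critical_cells K f p) = card (cells K p))"
proof -
  have iff: "card (critical_cells K f p) = card (cells K p) \<longleftrightarrow>
       cells K p \<inter> (Domain (gradient K f) \<union> Range (gradient K f)) = {}" for p
  proof
    assume "card (critical_cells K f p) = card (cells K p)"
    then have "critical_cells K f p = cells K p"
      using finite_cells by (intro card_subset_eq) (auto simp: critical_cells_def)
    then show "cells K p \<inter> (Domain (gradient K f) \<union> Range (gradient K f)) = {}"
      by (auto simp: critical_cells_gradient)
  qed (auto simp: critical_cells_gradient Diff_triv)
  show ?thesis
  proof
    assume sub: "gradient K f \<subseteq> ridge_pairs"
    have "cells K p \<inter> (Domain (gradient K f) \<union> Range (gradient K f)) = {}" if "p < int d - 1" for p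
      using sub that by (fastforce simp: ridge_pairs_def cells_def)
    then show "\<forall>p<int d - 1. card (critical_cells K f p) = card (cells K p)"
      using iff by blast
  next
    assume c: "\<forall>p<int d - 1. card (critical_cells K f p) = card (cells K p)"
    show "gradient K f \<subseteq> ridge_pairs"
    proof clarify
      fix \<sigma> \<tau> assume g: "(\<sigma>, \<tau>) \<in> gradient K f"
      then have K: "\<sigma> \<in> K" "\<tau> \<in> K" "codim1_face \<sigma> \<tau>" by (auto simp: gradient_def)
      then have "card \<sigma> \<le> d" using card_cell_le[of \<tau>] by (auto simp: codim1_face_def)
      moreover have "\<not> int (card \<sigma>) - 1 < int d - 1"
      proof
        assume "int (card \<sigma>) - 1 < int d - 1"
        then have "cells K (int (card \<sigma>) - 1) \<inter> Domain (gradient K f) = {}"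
          using c iff by blast
        moreover have "\<sigma> \<in> cells K (int (card \<sigma>) - 1)" using K by (simp add: cells_def)
        ultimately show False using g by blast
      qed
      ultimately have "card \<sigma> = d" by simp
      then show "(\<sigma>, \<tau>) \<in> ridge_pairs"
        using K by (auto simp: ridge_pairs_def ridges_iff facets_iff codim1_face_def)
    qed
  qed
qed

lemma gradient_matching:
  assumes "f \<in> discrete_morse_functions K"
  shows "(\<sigma>, \<tau>) \<in> gradient K f \<Longrightarrow> (\<sigma>, \<tau>') \<in> gradient K f \<Longrightarrow> \<tau> = \<tau>'"
    and "(\<sigma>, \<tau>) \<in> gradient K f \<Longrightarrow> (\<sigma>', \<tau>) \<in> gradient K f \<Longrightarrow> \<sigma> = \<sigma>'"
proof -
  \<comment> \<open>Finiteness matters because \<open>card\<close> is 0 on infinite sets, for which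
    the bound by 1 would say nothing.\<close>
  have fin: "finite (gradient K f)" 
    by (rule finite_subset[of _ "K \<times> K"]) (auto simp: gradient_def)
  then have fu: "finite {\<tau>. (\<sigma>, \<tau>) \<in> gradient K f}" and fl: "finite {\<tau>. (\<tau>, \<sigma>) \<in> gradient K f}" for \<sigma>
    using finite_subset[of "{\<tau>. (\<sigma>, \<tau>) \<in> gradient K f}" "Range (gradient K f)"] finite_Range[OF fin]
      finite_subset[of "{\<tau>. (\<tau>, \<sigma>) \<in> gradient K f}" "Domain (gradient K f)"] finite_Domain[OF fin] by auto
  have c: "card {\<tau>. (\<sigma>, \<tau>) \<in> gradient K f} \<le> 1 \<and> card {\<tau>. (\<tau>, \<sigma>) \<in> gradient K f} \<le> 1" if "\<sigma> \<in> K" for \<sigma>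
    using assms that by (simp add: discrete_morse_functions_def flip: lower_exceptions_gradient upper_exceptions_gradient)
  have one: "a = b" if "finite S" "card S \<le> 1" "a \<in> S" "b \<in> S" for a b :: "'a set" and S
    using that card_le_Suc0_iff_eq[of S] by auto
  show "(\<sigma>, \<tau>) \<in> gradient K f \<Longrightarrow> (\<sigma>, \<tau>') \<in> gradient K f \<Longrightarrow> \<tau> = \<tau>'"
    using one[OF fu[of \<sigma>]] c[of \<sigma>] by (auto simp: gradient_def)
  show "(\<sigma>, \<tau>) \<in> gradient K f \<Longrightarrow> (\<sigma>', \<tau>) \<in> gradient K f \<Longrightarrow> \<sigma> = \<sigma>'"
    using one[OF fl[of \<tau>]] c[of \<tau>] by (auto simp: gradient_def)
qed

text \<open>Facets occur only as upper cells of pairs, and each in at most one pair, so the facets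
  that are not critical correspond to the pairs.\<close>

lemma card_critical_facets:
  assumes f: "f \<in> discrete_morse_functions K" and sub: "gradient K f \<subseteq> ridge_pairs"
  shows "card (critical_cells K f (int d)) + card (gradient K f) = card facets"
proof -
  have inj: "inj_on snd (gradient K f)"
    using gradient_matching(2)[OF f] by (intro inj_onI) (metis prod.collapse)
  have R: "Range (gradient K f) \<subseteq> facets" using sub by (auto simp: ridge_pairs_def)
  have "facets \<inter> Domain (gradient K f) = {}" using sub by (force simp: ridge_pairs_def cells_def)
  then have "critical_cells K f (int d) = facets - Range (gradient K f)"
    by (auto simp: critical_cells_gradient)
  moreover have "card (Range (gradient K f)) = card (gradient K f)"
    using card_image[OF inj] by (simp add: Range_snd)
  ultimately show ?thesis
    using R card_mono[OF finite_cells R] finite_subset[OF R finite_cells] by (simp add: card_Diff_subset)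
qed

text \<open>A class is the fibre of the gradient map over its gradient, so counting classes amounts
  to counting gradients. A gradient with \<open>i\<close> pairs leaves
  \<open>card facets - i\<close> critical facets.\<close>

lemma card_morse_classes_with:
  "card (morse_classes_with K (int d) (int (card facets) - int i)) = card {V \<in> top_gradients. card V = i}"
proof -
  let ?\<Phi> = "\<lambda>V. {f \<in> discrete_morse_functions K. gradient K f = V}"
  let ?G = "{V \<in> top_gradients. card V = i}"
  have crit: "int (card (critical_cells K f (int d))) = int (card facets) - int i \<longleftrightarrow> card (gradient K f) = i"
    if "f \<in> discrete_morse_functions K" "gradient K f \<subseteq> ridge_pairs" for f
    using card_critical_facets[OF that] by linarith
  have cls: "morse_equiv K `` {f} = ?\<Phi> (gradient K f)" if "f \<in> discrete_morse_functions K" for f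
    using that by (auto simp: morse_equiv_def)
  have inj: "inj_on ?\<Phi> ?G"
  proof (rule inj_onI)
    fix V W assume V: "V \<in> ?G" and eq: "?\<Phi> V = ?\<Phi> W"
    then obtain f where "f \<in> discrete_morse_functions K" "V = gradient K f"
      unfolding top_gradients_def by blast
    then have "f \<in> ?\<Phi> V" by simp
    then have "f \<in> ?\<Phi> W" using eq by simp
    then show "V = W" using \<open>V = gradient K f\<close> by simp
  qed
  have "?\<Phi> ` ?G = morse_classes_with K (int d) (int (card facets) - int i)"
  proof (intro equalityI subsetI)
    fix C assume "C \<in> ?\<Phi> ` ?G"
    then obtain f where f: "f \<in> discrete_morse_functions K" "gradient K f \<subseteq> ridge_pairs" "card (gradient K f) = i"
      and C: "C = ?\<Phi> (gradient K f)" by (auto simp: top_gradients_def)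
    have "C \<in> morse_classes K"
      unfolding morse_classes_def C cls[OF f(1), symmetric] using f(1) by (rule quotientI)
    then show "C \<in> morse_classes_with K (int d) (int (card facets) - int i)"
      unfolding morse_classes_with_def using f crit[OF f(1,2)] gradient_subset_ridge_pairs_iff[of f] C by blast
  next
    fix C assume C: "C \<in> morse_classes_with K (int d) (int (card facets) - int i)"
    then obtain f where f: "f \<in> C" "int (card (critical_cells K f (int d))) = int (card facets) - int i"
        "gradient K f \<subseteq> ridge_pairs"
      unfolding morse_classes_with_def gradient_subset_ridge_pairs_iff by blast
    obtain f0 where f0: "f0 \<in> discrete_morse_functions K" "C = ?\<Phi> (gradient K f0)"
      using C cls unfolding morse_classes_with_def morse_classes_def by (auto elim!: quotientE)
    then have fD: "f \<in> discrete_morse_functions K" "C = ?\<Phi> (gradient K f)" using f(1) by auto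
    then show "C \<in> ?\<Phi> ` ?G"
      using f crit[OF fD(1) f(3)] by (auto simp: top_gradients_def)
  qed
  then show ?thesis using card_image[OF inj] by simp
qed

section \<open>Numbering of the ridges and entries of the Laplacian\<close>

definition nth_ridge :: "nat \<Rightarrow> 'a set" where
  "nth_ridge i = cell_list K (int d - 1) ! i"

lemma cell_list: "distinct (cell_list K p)" "set (cell_list K p) = cells K p" "length (cell_list K p) = card (cells K p)"
proof -
  have "\<exists>xs. distinct xs \<and> set xs = cells K p"
    using finite_distinct_list[OF finite_cells] by blast
  then have "distinct (cell_list K p) \<and> set (cell_list K p) = cells K p"
    unfolding cell_list_def by (rule someI_ex)
  then show "distinct (cell_list K p)" "set (cell_list K p) = cells K p" "length (cell_list K p) = card (cells K p)"
    using distinct_card by fastforce+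
qed

lemma bij_betw_cell_list: "bij_betw (\<lambda>i. cell_list K p ! i) {..<card (cells K p)} (cells K p)"
  using bij_betw_nth[OF cell_list(1)[of p] refl refl] cell_list(2,3) by simp

lemma nth_ridge_in: "i < card ridges \<Longrightarrow> nth_ridge i \<in> ridges"
  using bij_betw_cell_list[of "int d - 1"] unfolding nth_ridge_def bij_betw_def by blast

lemma nth_ridge_inj: "i < card ridges \<Longrightarrow> j < card ridges \<Longrightarrow> nth_ridge i = nth_ridge j \<longleftrightarrow> i = j"
  using bij_betw_cell_list[of "int d - 1"] unfolding nth_ridge_def bij_betw_def inj_on_def by blast

lemma ridge_eq_nth: "r \<in> ridges \<Longrightarrow> \<exists>i<card ridges. r = nth_ridge i"
  using bij_betw_cell_list[of "int d - 1"] unfolding nth_ridge_def bij_betw_def by blast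

lemma laplacian_entry:
  assumes "i < card ridges" "j < card ridges"
  shows "laplacian K (int d) $$ (i, j) = (\<Sum>f\<in>facets. incidence (nth_ridge i) f * incidence (nth_ridge j) f)"
proof -
  have "laplacian K (int d) $$ (i, j) =
      (\<Sum>k<card facets. incidence (nth_ridge i) (cell_list K (int d) ! k) * incidence (nth_ridge j) (cell_list K (int d) ! k))"
    using assms by (simp add: laplacian_def incidence_matrix_def scalar_prod_def nth_ridge_def lessThan_atLeast0)
  also have "\<dots> = (\<Sum>f\<in>facets. incidence (nth_ridge i) f * incidence (nth_ridge j) f)"
    by (rule sum.reindex_bij_betw[OF bij_betw_cell_list[of "int d"]])
  finally show ?thesis .
qed

lemma codim1_face_iff: "r \<in> ridges \<Longrightarrow> f \<in> facets \<Longrightarrow> codim1_face r f \<longleftrightarrow> r \<subseteq> f"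
  by (auto simp: codim1_face_def ridges_iff facets_iff)

lemma incidence_square:
  assumes "r \<in> ridges" "f \<in> facets" "r \<subseteq> f"
  shows "incidence r f * incidence r f = 1"
proof -
  have "codim1_face r f" "finite f" using assms finite_cell by (auto simp: codim1_face_iff facets_iff)
  then obtain j where "incidence r f = (-1) ^ j" using codim1_face_obtain_index by blast
  then show ?thesis by (simp flip: power_mult_distrib)
qed

lemma incidence_eq_0:
  assumes "\<not> r \<subseteq> f"
  shows "incidence r f = 0"
proof -
  have "(if r = f - {sorted_list_of_set f ! j} then (-1) ^ j else 0) = (0::real)" for j
    using assms by auto
  then show ?thesis unfolding incidence_def by (simp only: sum.neutral_const)
qed

lemma incidence_nonzero_iff:
  assumes "r \<in> ridges" "f \<in> facets"
  shows "incidence r f \<noteq> 0 \<longleftrightarrow> r \<subseteq> f"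
  using incidence_square[OF assms] incidence_eq_0[of r f] by fastforce

section \<open>Expansion over choices of one summand in each row\<close>

definition choices :: "(nat \<Rightarrow> 'a set option) set" where
  "choices = {0..<card ridges} \<rightarrow>\<^sub>E insert None (Some ` facets)"

definition choice_pairs :: "(nat \<Rightarrow> 'a set option) \<Rightarrow> ('a set \<times> 'a set) set" where
  "choice_pairs \<phi> = {(nth_ridge i, f) | i f. i < card ridges \<and> \<phi> i = Some f}"

text \<open>The summand of row \<open>i\<close> of the shifted Laplacian that belongs to
  \<open>c\<close>: \<open>None\<close> leaves ridge \<open>i\<close> unpaired and takes the
  diagonal term, \<open>Some f\<close> takes the incidence column of \<open>f\<close>, scaled by the
  incidence of ridge \<open>i\<close> in \<open>f\<close>.\<close>

definition choice_entry :: "real \<Rightarrow> 'a set option \<Rightarrow> nat \<Rightarrow> nat \<Rightarrow> real" where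
  "choice_entry lam c i j = (case c of None \<Rightarrow> if i = j then lam else 0
     | Some f \<Rightarrow> incidence (nth_ridge i) f * incidence (nth_ridge j) f)"

lemma choice_facet: "\<phi> \<in> choices \<Longrightarrow> i < card ridges \<Longrightarrow> \<phi> i = Some f \<Longrightarrow> f \<in> facets"
proof -
  assume "\<phi> \<in> choices" "i < card ridges" "\<phi> i = Some f"
  then have "Some f \<in> insert None (Some ` facets)"
    unfolding choices_def by (metis PiE_mem atLeastLessThan_iff zero_le)
  then show ?thesis by auto
qed

lemma finite_choices: "finite choices"
  unfolding choices_def by (intro finite_PiE) auto

lemma det_laplacian_expansion:
  "Determinant.det (laplacian K (int d) + lam \<cdot>\<^sub>m 1\<^sub>m (card ridges)) =
   (\<Sum>\<phi>\<in>choices. Determinant.det (mat (card ridges) (card ridges) (\<lambda>(i, j). choice_entry lam (\<phi> i) i j)))"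
proof -
  let ?n = "card ridges"
  have "laplacian K (int d) + lam \<cdot>\<^sub>m 1\<^sub>m ?n =
      mat ?n ?n (\<lambda>(i, j). \<Sum>c\<in>insert None (Some ` facets). choice_entry lam c i j)"
  proof (rule eq_matI)
    fix i j assume "i < dim_row (mat ?n ?n (\<lambda>(i, j). \<Sum>c\<in>insert None (Some ` facets). choice_entry lam c i j))"
      "j < dim_col (mat ?n ?n (\<lambda>(i, j). \<Sum>c\<in>insert None (Some ` facets). choice_entry lam c i j))"
    then have ij: "i < ?n" "j < ?n" by auto
    have "(\<Sum>c\<in>insert None (Some ` facets). choice_entry lam c i j) =
       (if i = j then lam else 0) + (\<Sum>f\<in>facets. incidence (nth_ridge i) f * incidence (nth_ridge j) f)"
      by (subst sum.insert) (auto simp: sum.reindex choice_entry_def)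
    then show "(laplacian K (int d) + lam \<cdot>\<^sub>m 1\<^sub>m ?n) $$ (i, j) =
      mat ?n ?n (\<lambda>(i, j). \<Sum>c\<in>insert None (Some ` facets). choice_entry lam c i j) $$ (i, j)"
      using ij laplacian_entry[OF ij] by simp
  qed (auto simp: laplacian_def incidence_matrix_def)
  then show ?thesis
    using det_sum_rows[of "insert None (Some ` facets)" ?n "\<lambda>i j c. choice_entry lam c i j"]
    by (simp add: choices_def)
qed

text \<open>A nonzero entry off the diagonal, in row \<open>i\<close> and column \<open>j\<close>,
  means that ridge \<open>j\<close> is a further face of the facet paired with ridge
  \<open>i\<close>. Its value under \<open>F\<close> is below that of the facet, hence below that of
  ridge \<open>i\<close>. So the determinant is the product of the diagonal, where a paired ridge
  contributes 1 and an unpaired one \<open>lam\<close>.\<close>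

lemma det_choice_morse:
  assumes \<phi>: "\<phi> \<in> choices" and F: "F \<in> discrete_morse_functions K" and V: "gradient K F = choice_pairs \<phi>"
  shows "Determinant.det (mat (card ridges) (card ridges) (\<lambda>(i, j). choice_entry lam (\<phi> i) i j)) =
           lam ^ (card ridges - card (choice_pairs \<phi>))"
proof -
  let ?n = "card ridges"
  have face: "nth_ridge i \<subseteq> f" if "i < ?n" "\<phi> i = Some f" for i f
  proof -
    have "(nth_ridge i, f) \<in> gradient K F" using V that by (auto simp: choice_pairs_def)
    then show ?thesis by (auto simp: gradient_def codim1_face_def)
  qed
  have dec: "F (nth_ridge j) < F (nth_ridge i)"
    if ij: "i < ?n" "j < ?n" "i \<noteq> j" and nz: "choice_entry lam (\<phi> i) i j \<noteq> 0" for i j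
  proof -
    obtain f where f: "\<phi> i = Some f"
      using nz ij(3) by (cases "\<phi> i") (auto simp: choice_entry_def)
    have fD: "f \<in> facets" using choice_facet[OF \<phi> ij(1) f] .
    have "incidence (nth_ridge j) f \<noteq> 0" using nz f by (auto simp: choice_entry_def)
    then have "nth_ridge j \<subseteq> f" using incidence_eq_0 by blast
    then have cj: "codim1_face (nth_ridge j) f" using codim1_face_iff nth_ridge_in ij(2) fD by blast
    have g: "(nth_ridge i, f) \<in> gradient K F" using V f ij by (auto simp: choice_pairs_def)
    have "(nth_ridge j, f) \<notin> gradient K F"
      using gradient_matching(2)[OF F g, of "nth_ridge j"] nth_ridge_inj[OF ij(1,2)] ij(3) by blast
    then have "F (nth_ridge j) < F f"
      using cj nth_ridge_in[OF ij(2)] fD by (auto simp: gradient_def cells_def)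
    also have "\<dots> \<le> F (nth_ridge i)" using g by (simp add: gradient_def)
    finally show ?thesis .
  qed
  have "Determinant.det (mat ?n ?n (\<lambda>(i, j). choice_entry lam (\<phi> i) i j)) = (\<Prod>i<?n. choice_entry lam (\<phi> i) i i)"
    using dec by (rule det_eq_prod_diag[where w = "\<lambda>i. F (nth_ridge i)"])
  also have "\<dots> = (\<Prod>i<?n. if \<phi> i = None then lam else 1)"
  proof (rule prod.cong)
    fix i assume "i \<in> {..<?n}"
    then show "choice_entry lam (\<phi> i) i i = (if \<phi> i = None then lam else 1)"
      using choice_facet[OF \<phi>, of i] face[of i] nth_ridge_in[of i] incidence_square[of "nth_ridge i"]
      by (cases "\<phi> i") (auto simp: choice_entry_def)
  qed simp
  also have "\<dots> = lam ^ card {i \<in> {..<?n}. \<phi> i = None}"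
    by (simp add: prod.If_cases Int_def)
  also have "card {i \<in> {..<?n}. \<phi> i = None} = ?n - card (choice_pairs \<phi>)"
  proof -
    let ?A = "{i \<in> {..<?n}. \<phi> i \<noteq> None}"
    have "choice_pairs \<phi> = (\<lambda>i. (nth_ridge i, the (\<phi> i))) ` ?A"
      by (force simp: choice_pairs_def)
    moreover have "inj_on (\<lambda>i. (nth_ridge i, the (\<phi> i))) ?A"
      using nth_ridge_inj by (auto simp: inj_on_def)
    ultimately have "card (choice_pairs \<phi>) = card ?A" by (simp add: card_image)
    moreover have "{i \<in> {..<?n}. \<phi> i = None} = {..<?n} - ?A" by auto
    moreover have "card ({..<?n} - ?A) = card {..<?n} - card ?A" by (intro card_Diff_subset) auto
    ultimately show ?thesis by simp
  qed
  finally show ?thesis .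
qed

text \<open>A gradient pairs each ridge with at most one facet, so it is the graph of a partial
  function on the ridges, which is a choice.\<close>

lemma bij_betw_choice_pairs:
  "bij_betw choice_pairs {\<phi> \<in> choices. choice_pairs \<phi> \<in> top_gradients} top_gradients"
  unfolding bij_betw_def
proof
  let ?n = "card ridges"
  have mem: "(nth_ridge i, f) \<in> choice_pairs \<phi> \<longleftrightarrow> \<phi> i = Some f" if "i < ?n" for i f \<phi>
    using that nth_ridge_inj by (auto simp: choice_pairs_def)
  show "inj_on choice_pairs {\<phi> \<in> choices. choice_pairs \<phi> \<in> top_gradients}"
  proof (rule inj_onI)
    fix \<phi> \<psi> assume a: "\<phi> \<in> {\<phi> \<in> choices. choice_pairs \<phi> \<in> top_gradients}"
      "\<psi> \<in> {\<phi> \<in> choices. choice_pairs \<phi> \<in> top_gradients}" and eq: "choice_pairs \<phi> = choice_pairs \<psi>"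
    have "\<phi> i = \<psi> i" if "i < ?n" for i
      using mem[OF that, of _ \<phi>] mem[OF that, of _ \<psi>] eq by (metis not_Some_eq)
    then show "\<phi> = \<psi>"
      using a unfolding choices_def by (intro PiE_ext[of \<phi> "{0..<?n}"]) auto
  qed
  have "V \<in> choice_pairs ` {\<phi> \<in> choices. choice_pairs \<phi> \<in> top_gradients}" if V: "V \<in> top_gradients" for V
  proof -
    obtain F where F: "F \<in> discrete_morse_functions K" "V = gradient K F" "V \<subseteq> ridge_pairs"
      using V by (auto simp: top_gradients_def)
    define \<phi> where "\<phi> = (\<lambda>i\<in>{0..<?n}. if \<exists>f. (nth_ridge i, f) \<in> V then Some (THE f. (nth_ridge i, f) \<in> V) else None)"
    have iff: "\<phi> i = Some f \<longleftrightarrow> (nth_ridge i, f) \<in> V" if i: "i < ?n" for i f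
    proof
      assume f: "(nth_ridge i, f) \<in> V"
      then have "(THE f. (nth_ridge i, f) \<in> V) = f"
        by (intro the_equality) (use gradient_matching(1)[OF F(1), folded F(2)] in auto)
      then show "\<phi> i = Some f" using i f by (auto simp: \<phi>_def)
    next
      assume a: "\<phi> i = Some f"
      then have "\<exists>f. (nth_ridge i, f) \<in> V" using i by (auto simp: \<phi>_def split: if_splits)
      then obtain g where g: "(nth_ridge i, g) \<in> V" by blast
      then have "(THE f. (nth_ridge i, f) \<in> V) = g"
        by (intro the_equality) (use gradient_matching(1)[OF F(1), folded F(2)] in auto)
      then have "\<phi> i = Some g" using i g by (auto simp: \<phi>_def)
      then show "(nth_ridge i, f) \<in> V" using a g by simp
    qed
    have "choice_pairs \<phi> = V"
    proof (intro equalityI subsetI)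
      fix x assume "x \<in> choice_pairs \<phi>"
      then show "x \<in> V" using iff by (auto simp: choice_pairs_def)
    next
      fix x assume x: "x \<in> V"
      then obtain r f where rf: "x = (r, f)" "r \<in> ridges" using F(3) by (auto simp: ridge_pairs_def)
      then obtain i where "i < ?n" "r = nth_ridge i" using ridge_eq_nth by blast
      then show "x \<in> choice_pairs \<phi>" using iff x rf by (auto simp: choice_pairs_def)
    qed
    moreover have "\<phi> i \<in> insert None (Some ` facets)" if i: "i < ?n" for i
    proof (cases "\<phi> i")
      case (Some f)
      then have "f \<in> facets" using iff[OF i] F(3) by (auto simp: ridge_pairs_def)
      then show ?thesis using Some by simp
    qed simp
    then have "\<phi> \<in> choices"
      unfolding choices_def by (intro PiE_I) (auto simp: \<phi>_def)
    ultimately show ?thesis using V by blast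
  qed
  then show "choice_pairs ` {\<phi> \<in> choices. choice_pairs \<phi> \<in> top_gradients} = top_gradients" by blast
qed

text \<open>The heights \<open>h\<close> order the pairs, and a discrete Morse function with the
  given gradient is built from them: the two cells of a pair get the same value, and on every other
  codimension-one face the value is strictly smaller than on the coface.\<close>

lemma choice_pairs_top_gradient:
  fixes h :: "nat \<Rightarrow> nat"
  assumes \<phi>: "\<phi> \<in> choices"
    and face: "\<And>i f. i < card ridges \<Longrightarrow> \<phi> i = Some f \<Longrightarrow> nth_ridge i \<subseteq> f"
    and inj: "\<And>i j f. i < card ridges \<Longrightarrow> j < card ridges \<Longrightarrow> \<phi> i = Some f \<Longrightarrow> \<phi> j = Some f \<Longrightarrow> i = j"
    and h: "\<And>i j f g. i < card ridges \<Longrightarrow> j < card ridges \<Longrightarrow> i \<noteq> j \<Longrightarrow> \<phi> i = Some f \<Longrightarrow> \<phi> j = Some g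
              \<Longrightarrow> nth_ridge j \<subseteq> f \<Longrightarrow> h j < h i"
  shows "choice_pairs \<phi> \<in> top_gradients"
proof -
  let ?n = "card ridges"
  define N where "N = (\<Sum>i<?n. h i)"
  have hN: "h i \<le> N" if "i < ?n" for i
    unfolding N_def using that by (intro member_le_sum) auto
  \<comment> \<open>\<open>P \<sigma> i\<close> says that \<open>\<sigma>\<close> is one of the two
    cells of the pair of ridge \<open>i\<close>.\<close>
  define P where "P \<sigma> i \<longleftrightarrow> i < ?n \<and> (\<phi> i = Some \<sigma> \<or> \<sigma> = nth_ridge i \<and> \<phi> i \<noteq> None)" for \<sigma> i
  \<comment> \<open>Unpaired cells below the facets get their number of vertices, hence at most
    \<open>d\<close>. Pairs lie above these at \<open>d + 1 + h i\<close>, and unpaired facets above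
    all pairs, because \<open>N\<close> bounds the heights.\<close>
  define F0 where "F0 \<sigma> = (if \<exists>i. P \<sigma> i then d + 1 + h (SOME i. P \<sigma> i)
      else if card \<sigma> = Suc d then d + 2 + N else card \<sigma>)" for \<sigma>
  define F where "F = (\<lambda>\<sigma>\<in>K. real (F0 \<sigma>))"
  have cr: "card (nth_ridge i) = d" if "i < ?n" for i using nth_ridge_in[OF that] ridges_iff by blast
  have cf: "card f = Suc d" if "i < ?n" "\<phi> i = Some f" for i f using choice_facet[OF \<phi> that] facets_iff by blast
  have Puniq: "i = j" if "P \<sigma> i" "P \<sigma> j" for \<sigma> i j
  proof (cases "card \<sigma> = d")
    case True
    have "\<sigma> = nth_ridge k" if "P \<sigma> k" for k
    proof -
      have "\<phi> k \<noteq> Some \<sigma>" using cf[of k \<sigma>] True that unfolding P_def by auto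
      then show ?thesis using that unfolding P_def by blast
    qed
    then have "\<sigma> = nth_ridge i" "\<sigma> = nth_ridge j" using that by blast+
    then show ?thesis using nth_ridge_inj that unfolding P_def by blast
  next
    case False
    have "\<phi> k = Some \<sigma>" if "P \<sigma> k" for k
    proof -
      have "\<sigma> \<noteq> nth_ridge k" using cr[of k] False that unfolding P_def by auto
      then show ?thesis using that unfolding P_def by blast
    qed
    then have "\<phi> i = Some \<sigma>" "\<phi> j = Some \<sigma>" using that by blast+
    then show ?thesis using inj that unfolding P_def by blast
  qed
  have FP: "F0 \<sigma> = d + 1 + h i" if "P \<sigma> i" for \<sigma> i
  proof -
    have "(SOME i. P \<sigma> i) = i" using that Puniq by (intro some_equality) auto
    then show ?thesis using that unfolding F0_def by auto
  qed
  have FnP: "F0 \<sigma> = (if card \<sigma> = Suc d then d + 2 + N else card \<sigma>)" if "\<And>i. \<not> P \<sigma> i" for \<sigma>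
  proof -
    have "\<not> (\<exists>i. P \<sigma> i)" using that by blast
    then show ?thesis unfolding F0_def by (simp only: if_False)
  qed
  have Pcard: "d \<le> card \<sigma>" if "P \<sigma> i" for \<sigma> i
    using that cr[of i] cf[of i \<sigma>] unfolding P_def by auto
  have main: "F0 \<tau> \<le> F0 \<sigma> \<longleftrightarrow> (\<sigma>, \<tau>) \<in> choice_pairs \<phi>"
    if \<sigma>: "\<sigma> \<in> K" and \<tau>: "\<tau> \<in> K" and st: "codim1_face \<sigma> \<tau>" for \<sigma> \<tau>
  proof -
    have cst: "card \<tau> = Suc (card \<sigma>)" "\<sigma> \<subseteq> \<tau>" using st by (auto simp: codim1_face_def)
    show ?thesis
    proof (cases "card \<sigma> = d")
      case False
      \<comment> \<open>Such a \<open>\<sigma>\<close> is unpaired and has the value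
        \<open>card \<sigma>\<close>, while the value of \<open>\<tau>\<close> is at least
        \<open>card \<tau>\<close>.\<close>
      then have small: "card \<sigma> < d" using card_cell_le[OF \<tau>] cst by simp
      then have "\<not> P \<sigma> i" for i using Pcard[of \<sigma> i] by auto
      then have "F0 \<sigma> = card \<sigma>" using FnP[of \<sigma>] small by simp
      moreover have "card \<tau> \<le> F0 \<tau>"
      proof (cases "\<exists>i. P \<tau> i")
        case True
        then obtain i where "P \<tau> i" by blast
        then show ?thesis using FP[of \<tau> i] small cst by simp
      next
        case False
        then show ?thesis using FnP[of \<tau>] small cst by simp
      qed
      moreover have "(\<sigma>, \<tau>) \<notin> choice_pairs \<phi>" using False cr by (auto simp: choice_pairs_def)
      ultimately show ?thesis using cst by simp
    next
      case True
      then have "\<sigma> \<in> ridges" using \<sigma> ridges_iff by blast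
      then obtain j where j: "j < ?n" "\<sigma> = nth_ridge j" using ridge_eq_nth by blast
      have \<tau>d: "card \<tau> = Suc d" using cst True by simp
      have Pt: "P \<tau> i \<longleftrightarrow> i < ?n \<and> \<phi> i = Some \<tau>" for i using \<tau>d cr[of i] unfolding P_def by auto
      have Fs: "F0 \<sigma> = (if \<phi> j = None then d else d + 1 + h j)"
      proof (cases "\<phi> j = None")
        case True
        then have "\<not> P \<sigma> i" for i
          using j cf[of i \<sigma>] nth_ridge_inj[of i j] \<open>card \<sigma> = d\<close> unfolding P_def by auto
        then show ?thesis using FnP[of \<sigma>] True \<open>card \<sigma> = d\<close> by simp
      next
        case False
        then show ?thesis using FP[of \<sigma> j] j unfolding P_def by simp
      qed
      have V: "(\<sigma>, \<tau>) \<in> choice_pairs \<phi> \<longleftrightarrow> \<phi> j = Some \<tau>"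
        using j nth_ridge_inj by (auto simp: choice_pairs_def)
      show ?thesis
      proof (cases "\<exists>i. P \<tau> i")
        case False
        then have "F0 \<tau> = d + 2 + N" using FnP[of \<tau>] \<tau>d by simp
        moreover have "F0 \<sigma> \<le> d + 1 + N" using Fs hN[OF j(1)] by simp
        moreover have "\<phi> j \<noteq> Some \<tau>" using False Pt j(1) by blast
        ultimately show ?thesis using V by simp
      next
        case True
        then obtain i where i: "i < ?n" "\<phi> i = Some \<tau>" using Pt by blast
        then have Ft: "F0 \<tau> = d + 1 + h i" using FP Pt by blast
        show ?thesis
        proof (cases "i = j")
          case True
          then show ?thesis using V i Ft Fs by simp
        next
          case neq: False
          then have "\<phi> j \<noteq> Some \<tau>" using inj i j by blast
          \<comment> \<open>A further ridge of \<open>\<tau>\<close> is lower by the assumption on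
            \<open>h\<close> if it is paired; otherwise its value is only \<open>d\<close>.\<close>
          moreover have "h j < h i" if "\<phi> j \<noteq> None"
            using h[OF i(1) j(1) neq i(2)] that j(2) cst(2) by blast
          then have "F0 \<sigma> < F0 \<tau>" using Ft Fs by auto
          ultimately show ?thesis using V by simp
        qed
      qed
    qed
  qed
  have pairs: "choice_pairs \<phi> \<subseteq> ridge_pairs"
    using nth_ridge_in choice_facet[OF \<phi>] face codim1_face_iff by (auto simp: choice_pairs_def ridge_pairs_def)
  have "(\<sigma>, \<tau>) \<in> gradient K F \<longleftrightarrow> (\<sigma>, \<tau>) \<in> choice_pairs \<phi>" for \<sigma> \<tau>
  proof -
    have "(\<sigma>, \<tau>) \<in> choice_pairs \<phi> \<Longrightarrow> \<sigma> \<in> K \<and> \<tau> \<in> K \<and> codim1_face \<sigma> \<tau>"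
      using pairs by (auto simp: ridge_pairs_def cells_def)
    then show ?thesis using main[of \<sigma> \<tau>] by (auto simp: gradient_def F_def)
  qed
  then have grad: "gradient K F = choice_pairs \<phi>" by auto
  have le1: "card S \<le> 1" if "\<And>a b. a \<in> S \<Longrightarrow> b \<in> S \<Longrightarrow> a = b" for S :: "'a set set"
    using that card_le_Suc0_iff_eq[of S] by (cases "finite S") auto
  have "F \<in> discrete_morse_functions K"
    unfolding discrete_morse_functions_def
  proof (intro CollectI conjI ballI)
    show "F \<in> K \<rightarrow>\<^sub>E UNIV" by (simp add: F_def)
    fix \<sigma> assume \<sigma>: "\<sigma> \<in> K"
    show "card (lower_exceptions K F \<sigma>) \<le> 1"
      unfolding lower_exceptions_gradient[OF \<sigma>] grad
      by (rule le1) (use inj in \<open>auto simp: choice_pairs_def\<close>)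
    show "card (upper_exceptions K F \<sigma>) \<le> 1"
      unfolding upper_exceptions_gradient[OF \<sigma>] grad
      by (rule le1) (use nth_ridge_inj in \<open>auto simp: choice_pairs_def\<close>)
  qed
  then show ?thesis using grad pairs by (auto simp: top_gradients_def)
qed

text \<open>A pair \<open>(j, i)\<close> of \<open>R\<close> says that the paired ridge
  \<open>j\<close> is a further face of the facet of ridge \<open>i\<close>. Coherence allows ridge
  \<open>j\<close> no third coface, so it has at most one successor, and the successor map permutes
  the ridges reachable from a point of a closed path. The weights of their facets, signed by
  incidences, form a kernel vector.\<close>

lemma det_choice_cyclic:
  assumes \<phi>: "\<phi> \<in> choices"
    and face: "\<And>i f. i < card ridges \<Longrightarrow> \<phi> i = Some f \<Longrightarrow> nth_ridge i \<subseteq> f"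
    and inj: "\<And>i j f. i < card ridges \<Longrightarrow> j < card ridges \<Longrightarrow> \<phi> i = Some f \<Longrightarrow> \<phi> j = Some f \<Longrightarrow> i = j"
    and or: "coherently_oriented K (int d) \<kappa>"
    and R: "R = {(j, i). i < card ridges \<and> j < card ridges \<and> i \<noteq> j \<and> \<phi> j \<noteq> None \<and> (\<exists>f. \<phi> i = Some f \<and> nth_ridge j \<subseteq> f)}"
    and cyc: "\<not> acyclic R"
  shows "Determinant.det (mat (card ridges) (card ridges) (\<lambda>(i, j). choice_entry lam (\<phi> i) i j)) = 0"
proof -
  let ?n = "card ridges"
  obtain a where a: "(a, a) \<in> R\<^sup>+" using cyc by (auto simp: acyclic_def)
  define C where "C = {j. (a, j) \<in> R\<^sup>+}"
  define F where "F i = the (\<phi> i)" for i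
  have R1: "i < ?n" "j < ?n" "i \<noteq> j" "\<phi> j = Some (F j)" "\<phi> i = Some (F i)" "nth_ridge j \<subseteq> F i" "nth_ridge j \<subseteq> F j"
      "F i \<noteq> F j" if "(j, i) \<in> R" for i j
  proof -
    show 1: "i < ?n" "j < ?n" "i \<noteq> j" "\<phi> j = Some (F j)" "\<phi> i = Some (F i)" "nth_ridge j \<subseteq> F i"
      using that by (auto simp: R F_def)
    show "nth_ridge j \<subseteq> F j" using face 1 by blast
    show "F i \<noteq> F j" using inj[of i j] 1 by auto
  qed
  have Ffacet: "F i \<in> facets" if "i < ?n" "\<phi> i \<noteq> None" for i
    using choice_facet[OF \<phi> that(1)] that(2) by (auto simp: F_def)
  \<comment> \<open>\<open>F j\<close>, \<open>F i\<close> and \<open>F k\<close> are cofaces of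
    ridge \<open>j\<close>, and the last two differ from the first, so they coincide; the pairing is
    injective.\<close>
  have func: "i = k" if "(j, i) \<in> R" "(j, k) \<in> R" for i j k
  proof -
    note i = R1[OF that(1)] and k = R1[OF that(2)]
    have "F k = F j \<or> F k = F i"
    proof (rule coherently_oriented_cofaces(2)[OF or nth_ridge_in[OF i(2)]])
      show "F j \<in> facets" "F i \<in> facets" "F k \<in> facets"
        using Ffacet[OF i(2)] Ffacet[OF i(1)] Ffacet[OF k(1)] i(4,5) k(5) by simp_all
    qed (use i k in simp_all)
    then have "F k = F i" using k(8) by blast
    then have "\<phi> k = Some (F i)" using k(5) by (simp only:)
    then show ?thesis by (rule inj[OF i(1) k(1) i(5)])
  qed
  \<comment> \<open>Successors are unique, so a path starting in \<open>a\<close> must follow the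
    closed path and can be continued back to \<open>a\<close>.\<close>
  have "\<exists>i\<in>C. (j, i) \<in> R" if j: "j \<in> C" for j
  proof -
    have "(j, a) \<in> R\<^sup>+"
    proof -
      have "(a, j) \<in> R\<^sup>+" using j by (simp add: C_def)
      then show ?thesis
      proof (induction rule: trancl_induct)
        case (base y)
        have "(a, y) \<in> R" by fact
        from a obtain z where z: "(a, z) \<in> R" "(z, a) \<in> R\<^sup>*" by (meson tranclD)
        then have "z = y" using func \<open>(a, y) \<in> R\<close> by blast
        then show ?case using z \<open>(a, y) \<in> R\<close> a by (meson rtrancl_into_trancl1 rtrancl_trancl_trancl trancl_into_rtrancl)
      next
        case (step y z)
        obtain w where w: "(y, w) \<in> R" "(w, a) \<in> R\<^sup>*" using step.IH by (meson tranclD)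
        then have "w = z" using func step.hyps by blast
        then show ?case using w a by (meson rtrancl_trancl_trancl)
      qed
    qed
    then obtain i where i: "(j, i) \<in> R" by (meson tranclD)
    then have "i \<in> C" using j by (auto simp: C_def)
    then show ?thesis using i by blast
  qed
  then obtain nxt where nxt: "\<And>j. j \<in> C \<Longrightarrow> nxt j \<in> C \<and> (j, nxt j) \<in> R" by metis
  have Csub: "C \<subseteq> {..<?n}"
  proof
    fix j assume "j \<in> C"
    then show "j \<in> {..<?n}" using nxt[of j] R1(2) by blast
  qed
  then have finC: "finite C" using finite_subset by blast
  have aC: "a \<in> C" using a by (simp add: C_def)
  \<comment> \<open>The last arrow of a path to \<open>j\<close> starts in \<open>C\<close> and is
    the \<open>nxt\<close> arrow of its source. A surjection of a finite set onto itself is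
    injective.\<close>
  have "C \<subseteq> nxt ` C"
  proof
    fix j assume "j \<in> C"
    then have "(a, j) \<in> R\<^sup>+" by (simp add: C_def)
    then obtain b where b: "(a, b) \<in> R\<^sup>*" "(b, j) \<in> R" by (meson tranclD2)
    then have "b \<in> C" using aC by (auto simp: C_def rtrancl_eq_or_trancl)
    then show "j \<in> nxt ` C" using nxt func b by blast
  qed
  then have surj: "nxt ` C = C" using nxt by blast
  then have injn: "inj_on nxt C" using finC by (simp add: eq_card_imp_inj_on)
  \<comment> \<open>In row \<open>i\<close> only \<open>i\<close> and its predecessor in \<open>C\<close> contribute; they cancel by coherence.\<close>
  define y where "y j = (if j \<in> C then real_of_int (\<kappa> (F j)) * incidence (nth_ridge j) (F j) else 0)" for j
  have sq: "incidence (nth_ridge j) (F j) * incidence (nth_ridge j) (F j) = 1" if "j < ?n" "\<phi> j \<noteq> None" for j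
    using incidence_square[OF nth_ridge_in[OF that(1)] Ffacet[OF that]] face[OF that(1)] that by (auto simp: F_def)
  have dom: "\<phi> j \<noteq> None" if "j \<in> C" for j using nxt[OF that] R1(4) by fastforce
  have "y a \<noteq> 0"
  proof -
    have an: "a < ?n" using aC Csub by blast
    then have "F a \<in> facets" by (rule Ffacet) (rule dom[OF aC])
    then have "\<kappa> (F a) \<noteq> 0" using or unfolding coherently_oriented_def by blast
    moreover have "incidence (nth_ridge a) (F a) \<noteq> 0" using sq[OF an dom[OF aC]] by auto
    ultimately show ?thesis using aC by (simp add: y_def)
  qed
  moreover have "(\<Sum>j<?n. choice_entry lam (\<phi> i) i j * y j) = 0" if i: "i < ?n" for i
  proof (cases "\<phi> i")
    case None
    then have "i \<notin> C" using dom by blast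
    then have "choice_entry lam (\<phi> i) i j * y j = 0" for j
      using None by (auto simp: choice_entry_def y_def)
    then show ?thesis by (simp only: sum.neutral_const)
  next
    case (Some f)
    then have f: "f = F i" "f \<in> facets" using Ffacet[OF i] by (auto simp: F_def)
    have rel: "j = i \<or> (j, i) \<in> R" if "j \<in> C" "nth_ridge j \<subseteq> f" for j
      using that Csub i Some dom unfolding R by auto
    have zero: "choice_entry lam (\<phi> i) i j * y j = 0" if "j \<noteq> i" "(j, i) \<notin> R" for j
    proof (cases "j \<in> C")
      case True
      then have "incidence (nth_ridge j) f = 0" using rel that incidence_eq_0 by blast
      then show ?thesis by (simp add: choice_entry_def Some)
    qed (simp add: y_def)
    show ?thesis
    proof (cases "i \<in> C")
      case False
      have "choice_entry lam (\<phi> i) i j * y j = 0" for j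
      proof (cases "j \<in> C")
        case True
        then have "j \<noteq> i" using False by blast
        \<comment> \<open>An arrow from \<open>j\<close> to \<open>i\<close> would be the
          \<open>nxt\<close> arrow, which stays in \<open>C\<close>.\<close>
        moreover have "(j, i) \<notin> R" using nxt[OF True] func False by blast
        ultimately show ?thesis by (rule zero)
      qed (simp add: y_def)
      then show ?thesis by (simp only: sum.neutral_const)
    next
      case True
      then obtain j where j: "j \<in> C" "i = nxt j" using surj by blast
      then have ji: "(j, i) \<in> R" using nxt by blast
      note r = R1[OF ji]
      have "choice_entry lam (\<phi> i) i k * y k = 0" if "k \<noteq> i" "k \<noteq> j" for k
      proof (cases "k \<in> C")
        case True
        \<comment> \<open>Injectivity of \<open>nxt\<close> leaves \<open>j\<close> as the only
          predecessor of \<open>i\<close> in \<open>C\<close>.\<close>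
        then have "(k, i) \<notin> R" using nxt[OF True] func[of k] j injn that(2) unfolding inj_on_def by blast
        then show ?thesis using zero that(1) by blast
      qed (simp add: y_def)
      then have "(\<Sum>k<?n. choice_entry lam (\<phi> i) i k * y k) = (\<Sum>k\<in>{i, j}. choice_entry lam (\<phi> i) i k * y k)"
        using r by (intro sum.mono_neutral_right) auto
      also have "\<dots> = choice_entry lam (\<phi> i) i i * y i + choice_entry lam (\<phi> i) i j * y j"
        using r(3) by simp
      also have "choice_entry lam (\<phi> i) i i * y i = real_of_int (\<kappa> (F i)) * incidence (nth_ridge i) (F i)"
        using True sq[OF i] Some f(1) by (simp add: choice_entry_def y_def)
      also have "choice_entry lam (\<phi> i) i j * y j =
          incidence (nth_ridge i) (F i) * (incidence (nth_ridge j) (F i) * (real_of_int (\<kappa> (F j)) * incidence (nth_ridge j) (F j)))"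
        using j(1) Some f(1) by (simp add: choice_entry_def y_def)
      also have "real_of_int (\<kappa> (F j)) * incidence (nth_ridge j) (F j) = - (real_of_int (\<kappa> (F i)) * incidence (nth_ridge j) (F i))"
      proof -
        have "real_of_int (\<kappa> (F j)) * incidence (nth_ridge j) (F j) + real_of_int (\<kappa> (F i)) * incidence (nth_ridge j) (F i) = 0"
        proof (rule coherently_oriented_cofaces(1)[OF or nth_ridge_in[OF r(2)]])
          show "F j \<in> facets" "F i \<in> facets" using Ffacet[OF r(2)] Ffacet[OF r(1)] r(4,5) by simp_all
        qed (use r in simp_all)
        then show ?thesis by linarith
      qed
      also have "incidence (nth_ridge j) (F i) * - (real_of_int (\<kappa> (F i)) * incidence (nth_ridge j) (F i)) = - real_of_int (\<kappa> (F i))"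
      proof -
        have "incidence (nth_ridge j) (F i) * incidence (nth_ridge j) (F i) = 1"
          using incidence_square[OF nth_ridge_in[OF r(2)] _ r(6)] f by simp
        then show ?thesis by (metis mult.assoc mult.commute mult.right_neutral mult_minus_right)
      qed
      finally show ?thesis by simp
    qed
  qed
  ultimately show ?thesis
    using aC Csub by (intro det_eq_0_right_kernel[where y = y and j = a]) auto
qed

text \<open>A choice can fail in three ways. If a ridge is not a face of its facet, its row is zero.
  If two ridges share a facet, their rows are proportional. Otherwise \<open>R\<close> must have a
  cycle, since an acyclic \<open>R\<close> provides the heights for a discrete Morse
  function.\<close>

lemma det_choice_not_morse:
  assumes \<phi>: "\<phi> \<in> choices" and V: "choice_pairs \<phi> \<notin> top_gradients"
    and or: "card ridges \<le> 1 \<or> coherently_oriented K (int d) \<kappa>"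
  shows "Determinant.det (mat (card ridges) (card ridges) (\<lambda>(i, j). choice_entry lam (\<phi> i) i j)) = 0"
proof -
  let ?n = "card ridges"
  show ?thesis
  proof (cases "\<exists>i f. i < ?n \<and> \<phi> i = Some f \<and> \<not> nth_ridge i \<subseteq> f")
    case True
    then obtain i f where i: "i < ?n" "\<phi> i = Some f" "\<not> nth_ridge i \<subseteq> f" by blast
    show ?thesis
    proof (rule det_eq_0_left_kernel[of i ?n "\<lambda>k. if k = i then 1 else 0"])
      fix j
      have "choice_entry lam (\<phi> k) k j * (if k = i then 1 else 0) = 0" for k
        using i incidence_eq_0 by (auto simp: choice_entry_def)
      then show "(\<Sum>k<?n. choice_entry lam (\<phi> k) k j * (if k = i then 1 else 0)) = 0"
        by (simp only: sum.neutral_const)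
    qed (use i in auto)
  next
    case False
    then have face: "\<And>i f. i < ?n \<Longrightarrow> \<phi> i = Some f \<Longrightarrow> nth_ridge i \<subseteq> f" by blast
    show ?thesis
    proof (cases "\<exists>i k f. i < ?n \<and> k < ?n \<and> i \<noteq> k \<and> \<phi> i = Some f \<and> \<phi> k = Some f")
      case True
      then obtain i k f where ik: "i < ?n" "k < ?n" "i \<noteq> k" "\<phi> i = Some f" "\<phi> k = Some f" by blast
      \<comment> \<open>Rows \<open>i\<close> and \<open>k\<close> are one and the same vector
        scaled by the two incidences in \<open>f\<close>, so exchanging these scalars with a sign
        cancels the rows.\<close>
      define y where "y l = (if l = i then incidence (nth_ridge k) f else if l = k then - incidence (nth_ridge i) f else 0)" for l
      have f: "f \<in> facets" using choice_facet[OF \<phi> ik(1,4)] .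
      show ?thesis
      proof (rule det_eq_0_left_kernel[of i ?n y])
        show "y i \<noteq> 0"
          using incidence_nonzero_iff[OF nth_ridge_in[OF ik(2)] f] face[OF ik(2,5)] by (simp add: y_def)
        fix j
        have "(\<Sum>l<?n. choice_entry lam (\<phi> l) l j * y l) = (\<Sum>l\<in>{i, k}. choice_entry lam (\<phi> l) l j * y l)"
          using ik by (intro sum.mono_neutral_right) (auto simp: y_def)
        also have "\<dots> = 0" using ik by (simp add: y_def choice_entry_def)
        finally show "(\<Sum>l<?n. choice_entry lam (\<phi> l) l j * y l) = 0" .
      qed (use ik in auto)
    next
      case False
      then have inj: "\<And>i j f. i < ?n \<Longrightarrow> j < ?n \<Longrightarrow> \<phi> i = Some f \<Longrightarrow> \<phi> j = Some f \<Longrightarrow> i = j" by blast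
      define R where "R = {(j, i). i < ?n \<and> j < ?n \<and> i \<noteq> j \<and> \<phi> j \<noteq> None \<and> (\<exists>f. \<phi> i = Some f \<and> nth_ridge j \<subseteq> f)}"
      have cyc: "\<not> acyclic R"
      proof
        assume ac: "acyclic R"
        \<comment> \<open>The number of ridges from which \<open>i\<close> can be reached; by
          acyclicity it grows strictly along \<open>R\<close>.\<close>
        define h where "h i = card {j. (j, i) \<in> R\<^sup>+}" for i
        have Rsub: "R \<subseteq> {..<?n} \<times> {..<?n}" by (auto simp: R_def)
        have fin: "finite {j. (j, i) \<in> R\<^sup>+}" for i
          by (rule finite_subset[of _ "{..<?n}"]) (use trancl_subset_Sigma[OF Rsub] in auto)
        have "h j < h i" if "(j, i) \<in> R" for i j
          unfolding h_def
        proof (rule psubset_card_mono[OF fin])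
          have "{k. (k, j) \<in> R\<^sup>+} \<subseteq> {k. (k, i) \<in> R\<^sup>+}" using that by auto
          moreover have "j \<in> {k. (k, i) \<in> R\<^sup>+}" "j \<notin> {k. (k, j) \<in> R\<^sup>+}"
            using that ac by (auto simp: acyclic_def)
          ultimately show "{k. (k, j) \<in> R\<^sup>+} \<subset> {k. (k, i) \<in> R\<^sup>+}" by blast
        qed
        then have "choice_pairs \<phi> \<in> top_gradients"
          by (intro choice_pairs_top_gradient[where h = h, OF \<phi> face inj]) (auto simp: R_def)
        then show False using V by blast
      qed
      \<comment> \<open>\<open>R\<close> relates only distinct ridges, so a cycle rules out the
        first alternative of \<open>or\<close>.\<close>
      have "\<not> ?n \<le> 1"
      proof -
        have "R \<noteq> {}" using cyc by (auto simp: acyclic_def)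
        then show ?thesis by (auto simp: R_def)
      qed
      then have "coherently_oriented K (int d) \<kappa>" using or by blast
      from \<phi> face inj this R_def cyc show ?thesis by (rule det_choice_cyclic)
    qed
  qed
qed

text \<open>Only the choices whose pairs form a gradient survive, each with a power of
  \<open>lam\<close>; grouping them by their number of pairs gives the coefficients.\<close>

lemma det_laplacian:
  assumes or: "card ridges \<le> 1 \<or> coherently_oriented K (int d) \<kappa>"
  shows "Determinant.det (laplacian K (int d) + lam \<cdot>\<^sub>m 1\<^sub>m (card ridges)) =
    (\<Sum>i=0..card ridges. real (card (morse_classes_with K (int d) (int (card facets) - int i))) * lam ^ (card ridges - i))"
proof -
  let ?n = "card ridges" and ?good = "{\<phi> \<in> choices. choice_pairs \<phi> \<in> top_gradients}"
  let ?det = "\<lambda>\<phi>. Determinant.det (mat ?n ?n (\<lambda>(i, j). choice_entry lam (\<phi> i) i j))"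
  \<comment> \<open>A gradient uses each ridge at most once, so the groups from 0 to
    \<open>?n\<close> exhaust all gradients.\<close>
  have le: "card V \<le> ?n" if V: "V \<in> top_gradients" for V
  proof -
    obtain F where F: "F \<in> discrete_morse_functions K" "V = gradient K F" "V \<subseteq> ridge_pairs"
      using V unfolding top_gradients_def by blast
    have "inj_on fst V" using gradient_matching(1)[OF F(1), folded F(2)] by (intro inj_onI) (metis prod.collapse)
    moreover have "fst ` V \<subseteq> ridges" using F(3) by (auto simp: ridge_pairs_def)
    ultimately show ?thesis by (intro card_inj_on_le) auto
  qed
  have "Determinant.det (laplacian K (int d) + lam \<cdot>\<^sub>m 1\<^sub>m ?n) = (\<Sum>\<phi>\<in>choices. ?det \<phi>)"
    by (rule det_laplacian_expansion)
  also have "\<dots> = (\<Sum>\<phi>\<in>?good. ?det \<phi>)"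
    using det_choice_not_morse[OF _ _ or] finite_choices by (intro sum.mono_neutral_right) auto
  also have "\<dots> = (\<Sum>\<phi>\<in>?good. lam ^ (?n - card (choice_pairs \<phi>)))"
  proof (rule sum.cong)
    fix \<phi> assume "\<phi> \<in> ?good"
    then obtain F where "\<phi> \<in> choices" "F \<in> discrete_morse_functions K" "gradient K F = choice_pairs \<phi>"
      unfolding top_gradients_def by blast
    then show "?det \<phi> = lam ^ (?n - card (choice_pairs \<phi>))" by (rule det_choice_morse)
  qed simp
  also have "\<dots> = (\<Sum>V\<in>top_gradients. lam ^ (?n - card V))"
    by (rule sum.reindex_bij_betw[OF bij_betw_choice_pairs])
  also have "\<dots> = (\<Sum>i\<in>{0..?n}. \<Sum>V\<in>{V \<in> top_gradients. card V = i}. lam ^ (?n - card V))"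
    using le finite_top_gradients by (intro sum.group[symmetric]) auto
  also have "\<dots> = (\<Sum>i=0..?n. real (card {V \<in> top_gradients. card V = i}) * lam ^ (?n - i))"
    by (intro sum.cong) auto
  finally show ?thesis by (simp add: card_morse_classes_with)
qed

end

theorem theorem4p5:
  fixes K :: "'a::linorder set set" and M :: "'b topology" and d m n :: nat and lam :: real
  assumes "abstract_simplicial_complex K"
    and "has_dimension K (int d)"
    and "orientable_manifold d M"
    and "geometric_realization K homeomorphic_space M"
    and "m = card (cells K (int d))"
    and "n = card (cells K (int d - 1))"
  shows "Determinant.det (laplacian K (int d) + lam \<cdot>\<^sub>m 1\<^sub>m n) =
    (\<Sum>i=0..n. real (card (morse_classes_with K (int d) (int m - int i))) * lam ^ (n - i))"
proof -
  interpret simplicial_complex_dim K d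
    using assms(1,2) by unfold_locales
  have "\<exists>\<kappa>. card ridges \<le> 1 \<or> coherently_oriented K (int d) \<kappa>"
  proof (cases "d = 0")
    case True
    \<comment> \<open>The empty cell may have more than two cofaces, but a closed path needs two ridges.\<close>
    have "r = {}" if "r \<in> ridges" for r
      using that[unfolded ridges_iff] True finite_cell[of r] by auto
    then have "ridges \<subseteq> {{}}" by blast
    then have "card ridges \<le> 1"
      using card_mono[of "{{}}" ridges] by simp
    then show ?thesis by blast
  next
    case False
    obtain \<mu> where "Hausdorff_space M" "orientation d M \<mu>"
      using assms(3) unfolding orientable_manifold_def topological_manifold_def by blast
    moreover obtain \<phi> \<psi> where "homeomorphic_maps (geometric_realization K) M \<phi> \<psi>"
      using assms(4) unfolding homeomorphic_space_def by blast
    ultimately show ?thesis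
      using coherent_orientation_exists[OF assms(1,2)] False by fastforce
  qed
  then show ?thesis
    using det_laplacian assms(5,6) by blast
qed

end
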